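(* Let $\Omega\subset\mathbb{R}^n$ be a bounded open set, $1<p<\infty$, and let $X=(X_1,\dots,X_m)$ satisfy (LIC) on $\Omega$ and conditions (H1), (H2), (H3). Let $f_h,f\in I_{m,p}(\Omega,c_0,c_1,a_0,a_1)$ ($h\in\mathbb{N}$) with $a_0,a_1\in L^\infty(\Omega)$, and let $F_h,F:W^{1,p}_{X,0}(\Omega)\to\mathbb{R}$ be defined by $$F_h(u):=\int_\Omega f_h(x,Xu(x))\,dx,\qquad F(u):=\int_\Omega f(x,Xu(x))\,dx .$$ Assume that for every $\eta\in\mathbb{R}^m$, $f_h(\cdot,\eta)\to f(\cdot,\eta)$ a.e. in $\Omega$ as $h\to\infty$. Then $(F_h)_h$ $\Gamma$-converges to $F$ in the weak topology of $W^{1,p}_{X,0}(\Omega)$. Moreover, suppose that $W^{1,p}_X(\Omega)$ is compactly embedded in $L^p(\Omega)$, let now $F_h,F:W^{1,p}_X(\Omega)\to\mathbb{R}$ be defined by the same formulas for every $u\in W^{1,p}_X(\Omega)$, and let $G:W^{1,p}_X(\Omega)\to\mathbb{R}$, $G(u):=\int_\Omega g(x,u(x))\,dx$, where $g:\Omega\times\mathbb{R}\to\mathbb{R}$ is a Carathéodory function for which there are constants $0<d_0\le d_1$ and nonnegative $b_0,b_1\in L^1(\Omega)$ with $$d_0|s|^p-b_0(x)\le g(x,s)\le d_1|s|^p+b_1(x)\quad\text{for a.e. }x\in\Omega\text{ and every }s\in\mathbb{R}.$$ Then $(F_h+G)_h$ $\Gamma$-converges to $F+G$ in the weak topology of $W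^{1,p}_X(\Omega)$.
   Context: Vector fields. $X=(X_1,\dots,X_m)$ is a family of first-order operators $X_j(x)=\sum_{i=1}^n c_{ji}(x)\partial_i$, with $X_j$ identified with the vector field $(c_{j1},\dots,c_{jn})$. It is defined and Lipschitz continuous on an open neighborhood $\Omega_0$ of $\overline\Omega$ (coefficients being extended to locally Lipschitz functions on $\mathbb{R}^n$). (LIC) on $\Omega$: there is a set $\mathcal N_X\subset\Omega$, closed in the topology of $\Omega$, with Lebesgue measure $|\mathcal N_X|=0$, such that $X_1(x),\dots,X_m(x)$ are linearly independent vectors of $\mathbb{R}^n$ for every $x\in\Omega\setminus\mathcal N_X$. Carnot–Carathéodory distance: an absolutely continuous curve $\gamma:[0,T]\to\mathbb{R}^n$ is subunit if for a.e. $t$, $\langle\dot\gamma(t),\xi\rangle^2\le\sum_{j=1}^m\langle X_j(\gamma(t)),\xi\rangle^2$ for all $\xi\in\mathbb{R}^n$; $d(x,y)\in[0,\infty]$ is the infimum of the $T\ge 0$ such that some subunit $\gamma:[0,T]\to\mathbb{R}^n$ joins $x$ to $y$ ($\inf\emptyset=\infty$). $B_d(x,r):=\{y\in\Omega_0: d(x,y)<r\}$. (H1) $d(x,y)<\infty$ for all $x,y\in\Omega_0$, so $d$ is a distance on $\Omega_0$, and $d$ is continuous with respect to the usual topology of $\mathbb{R}^n$. (H2) For every compact $K\subset\Omega_0$ there are $r_K>0$, $C_K>0$ with $|B_d(x,2r)|\le C_K|B_d(x,r)|$ for all $x\in K$, $r<r_K$. (H3) There are geometric constants $c,C>0$ such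 that for every ball $B=B_d(\bar x,r)$ with $cB:=B_d(\bar x,cr)\subseteq\Omega_0$, every $u\in\mathrm{Lip}(c\overline B)$ and every $x\in\overline B$, $$\Big|u(x)-\frac1{|B|}\int_B u(y)\,dy\Big|\le C\int_{cB}|Xu(y)|\frac{d(x,y)}{|B_d(x,d(x,y))|}\,dy .$$ Sobolev spaces. For $u\in L^1(\Omega)$, $X_ju$ is the distribution $\psi\mapsto-\int_\Omega u\sum_{i=1}^n\partial_i(c_{ji}\psi)\,dx$, $\psi\in C_c^\infty(\Omega)$, and $Xu=(X_1u,\dots,X_mu)$. $W^{1,p}_X(\Omega)=\{u\in L^p(\Omega): X_ju\in L^p(\Omega),\ j=1,\dots,m\}$ with norm $(\int_\Omega|u|^p+\int_\Omega|Xu|^p)^{1/p}$; $W^{1,p}_{X,0}(\Omega)$ is the closure of $C^1_c(\Omega)\cap W^{1,p}_X(\Omega)$ in $W^{1,p}_X(\Omega)$. Integrands. For constants $0<c_0\le c_1$ and nonnegative $a_0,a_1\in L^1(\Omega)$, $I_{m,p}(\Omega,c_0,c_1,a_0,a_1)$ is the class of functions $f:\Omega\times\mathbb{R}^m\to\mathbb{R}$ that are Borel measurable, with $f(x,\cdot)$ convex for a.e. $x\in\Omega$, and $c_0|\eta|^p-a_0(x)\le f(x,\eta)\le c_1|\eta|^p+a_1(x)$ for a.e. $x\in\Omega$ and each $\eta\in\mathbb{R}^m$. $\Gamma$-convergence on a topological space $Y$: $(F_h)_h$ $\Gamma$-converges to $F$ if for every $u\in Y$, $F(u)=\sup_U\liminf_{h}\inf_{v\in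 U}F_h(v)=\sup_U\limsup_{h}\inf_{v\in U}F_h(v)$, where $U$ ranges over the open neighbourhoods of $u$ in $Y$. *)

theory Defs
  imports "HOL-Analysis.Analysis"
begin

text \<open>
  A family \<open>X\<close> of \<open>m\<close> vector fields on \<open>n\<close>-space is a function \<open>X :: 'm \<Rightarrow> real^'n \<Rightarrow> real^'n\<close>; the
  coefficient \<open>c\<close> with indices \<open>j\<close>, \<open>i\<close> at \<open>x\<close> is \<open>X j x $ i\<close>.
\<close>

section \<open>Vector fields and the Carnot--Caratheodory distance\<close>

definition LIC :: "('m::finite \<Rightarrow> real^'n \<Rightarrow> real^'n) \<Rightarrow> (real^'n) set \<Rightarrow> bool" where
  "LIC X \<Omega> \<longleftrightarrow>
     (\<exists>N. N \<subseteq> \<Omega> \<and> closedin (top_of_set \<Omega>) N \<and> N \<in> null_sets lebesgue \<and>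
          (\<forall>x\<in>\<Omega> - N. inj (\<lambda>j. X j x) \<and> independent (range (\<lambda>j. X j x))))"

text \<open>A finite family of nonoverlapping compact subintervals of \<open>[a, b]\<close> is a division
  of its union.\<close>

definition abs_continuous_on_interval :: "real \<Rightarrow> real \<Rightarrow> (real \<Rightarrow> 'a::real_normed_vector) \<Rightarrow> bool" where
  "abs_continuous_on_interval a b \<gamma> \<longleftrightarrow>
     (\<forall>\<epsilon>>0. \<exists>\<delta>>0. \<forall>\<D> S. \<D> division_of S \<and> S \<subseteq> {a..b} \<and> (\<Sum>K\<in>\<D>. Sup K - Inf K) < \<delta> \<longrightarrow>
        (\<Sum>K\<in>\<D>. norm (\<gamma> (Sup K) - \<gamma> (Inf K))) < \<epsilon>)"

definition subunit :: "('m::finite \<Rightarrow> real^'n \<Rightarrow> real^'n) \<Rightarrow> real \<Rightarrow> (real \<Rightarrow> real^'n) \<Rightarrow> bool" where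
  "subunit X T \<gamma> \<longleftrightarrow>
     abs_continuous_on_interval 0 T \<gamma> \<and>
     (AE t in lebesgue_on {0..T}. \<exists>v. (\<gamma> has_vector_derivative v) (at t within {0..T}) \<and>
        (\<forall>\<xi>. (v \<bullet> \<xi>)\<^sup>2 \<le> (\<Sum>j\<in>UNIV. (X j (\<gamma> t) \<bullet> \<xi>)\<^sup>2)))"

definition cc_dist :: "('m::finite \<Rightarrow> real^'n \<Rightarrow> real^'n) \<Rightarrow> real^'n \<Rightarrow> real^'n \<Rightarrow> ennreal" where
  "cc_dist X x y = Inf {ennreal T |T. 0 \<le> T \<and> (\<exists>\<gamma>. subunit X T \<gamma> \<and> \<gamma> 0 = x \<and> \<gamma> T = y)}"

definition cc_ball ::
  "('m::finite \<Rightarrow> real^'n \<Rightarrow> real^'n) \<Rightarrow> (real^'n) set \<Rightarrow> real^'n \<Rightarrow> ennreal \<Rightarrow> (real^'n) set" where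
  "cc_ball X \<Omega>0 x r = {y \<in> \<Omega>0. cc_dist X x y < r}"

definition H1 :: "('m::finite \<Rightarrow> real^'n \<Rightarrow> real^'n) \<Rightarrow> (real^'n) set \<Rightarrow> bool" where
  "H1 X \<Omega>0 \<longleftrightarrow>
     (\<forall>x\<in>\<Omega>0. \<forall>y\<in>\<Omega>0. cc_dist X x y < \<infinity>) \<and>
     continuous_on (\<Omega>0 \<times> \<Omega>0) (\<lambda>(x, y). cc_dist X x y)"

definition H2 :: "('m::finite \<Rightarrow> real^'n \<Rightarrow> real^'n) \<Rightarrow> (real^'n) set \<Rightarrow> bool" where
  "H2 X \<Omega>0 \<longleftrightarrow>
     (\<forall>K. compact K \<and> K \<subseteq> \<Omega>0 \<longrightarrow>
        (\<exists>rK>0. \<exists>CK>0. \<forall>x\<in>K. \<forall>r::real. 0 < r \<and> r < rK \<longrightarrow>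
           emeasure lebesgue (cc_ball X \<Omega>0 x (ennreal (2 * r)))
             \<le> ennreal CK * emeasure lebesgue (cc_ball X \<Omega>0 x (ennreal r))))"

section \<open>Test functions and the distributional gradient along \<open>X\<close>\<close>

definition partial_deriv :: "'n::finite \<Rightarrow> (real^'n \<Rightarrow> real) \<Rightarrow> real^'n \<Rightarrow> real" where
  "partial_deriv i f x = deriv (\<lambda>t. f (x + t *\<^sub>R axis i 1)) 0"

primrec Ck :: "nat \<Rightarrow> (real^'n::finite \<Rightarrow> real) \<Rightarrow> bool" where
  "Ck 0 f \<longleftrightarrow> continuous_on UNIV f"
| "Ck (Suc k) f \<longleftrightarrow> (\<forall>x. f differentiable (at x)) \<and> (\<forall>i. Ck k (partial_deriv i f))"

text \<open>Functions compactly supported in \<open>\<Omega>\<close> are regarded as defined on the whole space,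
  being extended by zero.\<close>

definition compact_support_in :: "(real^'n::finite \<Rightarrow> real) \<Rightarrow> (real^'n) set \<Rightarrow> bool" where
  "compact_support_in f \<Omega> \<longleftrightarrow> compact (closure {x. f x \<noteq> 0}) \<and> closure {x. f x \<noteq> 0} \<subseteq> \<Omega>"

definition C1c :: "(real^'n::finite) set \<Rightarrow> (real^'n \<Rightarrow> real) set" where
  "C1c \<Omega> = {\<phi>. Ck 1 \<phi> \<and> compact_support_in \<phi> \<Omega>}"

definition Cinfc :: "(real^'n::finite) set \<Rightarrow> (real^'n \<Rightarrow> real) set" where
  "Cinfc \<Omega> = {\<psi>. (\<forall>k. Ck k \<psi>) \<and> compact_support_in \<psi> \<Omega>}"

text \<open>The distribution \<open>X\<^sub>j u\<close> is represented by the \<open>j\<close>-th component of \<open>v\<close>, for every \<open>j\<close>.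
  The partial derivatives of the products of \<open>\<psi>\<close> with the locally Lipschitz coefficients
  exist almost everywhere.\<close>

definition is_weak_Xgrad ::
  "('m::finite \<Rightarrow> real^'n \<Rightarrow> real^'n) \<Rightarrow> (real^'n) set \<Rightarrow> (real^'n \<Rightarrow> real) \<Rightarrow> (real^'n \<Rightarrow> real^'m) \<Rightarrow> bool" where
  "is_weak_Xgrad X \<Omega> u v \<longleftrightarrow>
     v \<in> borel_measurable (lebesgue_on \<Omega>) \<and>
     (\<forall>K. compact K \<and> K \<subseteq> \<Omega> \<longrightarrow> integrable (lebesgue_on K) v) \<and>
     (\<forall>j. \<forall>\<psi>\<in>Cinfc \<Omega>.
        (LINT x|lebesgue_on \<Omega>. v x $ j * \<psi> x) =
        - (LINT x|lebesgue_on \<Omega>. u x * (\<Sum>i\<in>UNIV. partial_deriv i (\<lambda>y. X j y $ i * \<psi> y) x)))"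

text \<open>A representative of \<open>Xu\<close>; it is determined up to a null set whenever it exists.\<close>

definition Xgrad ::
  "('m::finite \<Rightarrow> real^'n \<Rightarrow> real^'n) \<Rightarrow> (real^'n) set \<Rightarrow> (real^'n \<Rightarrow> real) \<Rightarrow> real^'n \<Rightarrow> real^'m" where
  "Xgrad X \<Omega> u = (SOME v. is_weak_Xgrad X \<Omega> u v)"

text \<open>The closures of the balls are taken in \<open>\<Omega>0\<close>, where \<open>d\<close> is a distance, and Lipschitz continuity
  of \<open>u\<close> refers to the Euclidean metric. The inclusion of the dilated ball in \<open>\<Omega>0\<close> is kept although
  it is implied by the definition of \<open>cc_ball\<close>. Integrability of \<open>u\<close> on \<open>B\<close>, which is automatic for
  bounded \<open>B\<close>, makes the mean value meaningful. The right-hand side may be infinite.\<close>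

definition H3 :: "('m::finite \<Rightarrow> real^'n \<Rightarrow> real^'n) \<Rightarrow> (real^'n) set \<Rightarrow> bool" where
  "H3 X \<Omega>0 \<longleftrightarrow>
     (\<exists>c>0. \<exists>C>0. \<forall>xb\<in>\<Omega>0. \<forall>r>0.
        let B = cc_ball X \<Omega>0 xb (ennreal r); cB = cc_ball X \<Omega>0 xb (ennreal (c * r)) in
        cB \<subseteq> \<Omega>0 \<longrightarrow>
        (\<forall>u. (\<exists>L. L-lipschitz_on (closure cB \<inter> \<Omega>0) u) \<and> set_integrable lebesgue B u \<longrightarrow>
          (\<forall>x\<in>closure B \<inter> \<Omega>0.
             ennreal \<bar>u x - (1 / measure lebesgue B) * (LINT y:B|lebesgue. u y)\<bar>
               \<le> ennreal C *
                 (\<integral>\<^sup>+ y\<in>cB. ennreal (norm (Xgrad X cB u y)) *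
                    (cc_dist X x y / emeasure lebesgue (cc_ball X \<Omega>0 x (cc_dist X x y))) \<partial>lebesgue))))"

section \<open>Sobolev spaces\<close>

text \<open>As usual for the library, elements of function spaces are functions rather than classes of
  functions modulo equality almost everywhere on \<open>\<Omega>\<close>; values outside \<open>\<Omega>\<close> are irrelevant. The norm
  is thus a seminorm, and functions equal almost everywhere on \<open>\<Omega>\<close> lie in the same (weakly) open
  sets.\<close>

definition Lp :: "real \<Rightarrow> (real^'n::finite) set \<Rightarrow> (real^'n \<Rightarrow> 'b::euclidean_space) set" where
  "Lp p \<Omega> = {u. u \<in> borel_measurable (lebesgue_on \<Omega>) \<and>
               integrable (lebesgue_on \<Omega>) (\<lambda>x. norm (u x) powr p)}"

definition Lp_norm :: "real \<Rightarrow> (real^'n::finite) set \<Rightarrow> (real^'n \<Rightarrow> 'b::euclidean_space) \<Rightarrow> real" where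
  "Lp_norm p \<Omega> u = (LINT x|lebesgue_on \<Omega>. norm (u x) powr p) powr (1 / p)"

definition W1pX ::
  "('m::finite \<Rightarrow> real^'n \<Rightarrow> real^'n) \<Rightarrow> real \<Rightarrow> (real^'n) set \<Rightarrow> (real^'n \<Rightarrow> real) set" where
  "W1pX X p \<Omega> = {u \<in> Lp p \<Omega>. \<exists>v\<in>Lp p \<Omega>. is_weak_Xgrad X \<Omega> u v}"

definition W1pX_norm ::
  "('m::finite \<Rightarrow> real^'n \<Rightarrow> real^'n) \<Rightarrow> real \<Rightarrow> (real^'n) set \<Rightarrow> (real^'n \<Rightarrow> real) \<Rightarrow> real" where
  "W1pX_norm X p \<Omega> u =
     ((LINT x|lebesgue_on \<Omega>. \<bar>u x\<bar> powr p) +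
      (LINT x|lebesgue_on \<Omega>. norm (Xgrad X \<Omega> u x) powr p)) powr (1 / p)"

definition W1pX0 ::
  "('m::finite \<Rightarrow> real^'n \<Rightarrow> real^'n) \<Rightarrow> real \<Rightarrow> (real^'n) set \<Rightarrow> (real^'n \<Rightarrow> real) set" where
  "W1pX0 X p \<Omega> = {u \<in> W1pX X p \<Omega>.
     \<forall>\<epsilon>>0. \<exists>\<phi>\<in>C1c \<Omega> \<inter> W1pX X p \<Omega>. W1pX_norm X p \<Omega> (\<lambda>x. u x - \<phi> x) < \<epsilon>}"

definition compactly_embedded_in_Lp ::
  "('m::finite \<Rightarrow> real^'n \<Rightarrow> real^'n) \<Rightarrow> real \<Rightarrow> (real^'n) set \<Rightarrow> bool" where
  "compactly_embedded_in_Lp X p \<Omega> \<longleftrightarrow>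
     (\<forall>u M. (\<forall>k::nat. u k \<in> W1pX X p \<Omega> \<and> W1pX_norm X p \<Omega> (u k) \<le> M) \<longrightarrow>
        (\<exists>v\<in>Lp p \<Omega>. \<exists>r::nat \<Rightarrow> nat. strict_mono r \<and>
           (\<lambda>k. Lp_norm p \<Omega> (\<lambda>x. u (r k) x - v x)) \<longlonglongrightarrow> 0))"

section \<open>Weak topology and \<open>\<Gamma>\<close>-convergence\<close>

text \<open>\<open>V\<close> is a linear space of real functions, with (semi)norm \<open>nrm\<close>. Functionals are
  total functions whose values off \<open>V\<close> are irrelevant.\<close>

definition dual_of :: "('a \<Rightarrow> real) set \<Rightarrow> (('a \<Rightarrow> real) \<Rightarrow> real) \<Rightarrow> (('a \<Rightarrow> real) \<Rightarrow> real) set" where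
  "dual_of V nrm = {l.
     (\<forall>u\<in>V. \<forall>v\<in>V. l (\<lambda>x. u x + v x) = l u + l v) \<and>
     (\<forall>a. \<forall>u\<in>V. l (\<lambda>x. a * u x) = a * l u) \<and>
     (\<exists>C. \<forall>u\<in>V. \<bar>l u\<bar> \<le> C * nrm u)}"

definition weak_topology_of :: "('a \<Rightarrow> real) set \<Rightarrow> (('a \<Rightarrow> real) \<Rightarrow> real) \<Rightarrow> ('a \<Rightarrow> real) topology" where
  "weak_topology_of V nrm =
     topology_generated_by {{u \<in> V. l u \<in> S} |l S. l \<in> dual_of V nrm \<and> open S}"

definition Gamma_converges :: "'a topology \<Rightarrow> (nat \<Rightarrow> 'a \<Rightarrow> real) \<Rightarrow> ('a \<Rightarrow> real) \<Rightarrow> bool" where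
  "Gamma_converges Y F F0 \<longleftrightarrow>
     (\<forall>u\<in>topspace Y.
        ereal (F0 u) = (SUP U\<in>{U. openin Y U \<and> u \<in> U}. liminf (\<lambda>h. INF v\<in>U. ereal (F h v))) \<and>
        ereal (F0 u) = (SUP U\<in>{U. openin Y U \<and> u \<in> U}. limsup (\<lambda>h. INF v\<in>U. ereal (F h v))))"

section \<open>Integrands and integral functionals\<close>

definition integrand_class ::
  "real \<Rightarrow> (real^'n::finite) set \<Rightarrow> real \<Rightarrow> real \<Rightarrow> (real^'n \<Rightarrow> real) \<Rightarrow> (real^'n \<Rightarrow> real) \<Rightarrow>
     (real^'n \<Rightarrow> real^'m::finite \<Rightarrow> real) set" where
  "integrand_class p \<Omega> c0 c1 a0 a1 = {f.
     (\<lambda>(x, \<eta>). f x \<eta>) \<in> borel_measurable (restrict_space borel (\<Omega> \<times> UNIV)) \<and>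
     (AE x in lebesgue_on \<Omega>. convex_on UNIV (f x)) \<and>
     (AE x in lebesgue_on \<Omega>. \<forall>\<eta>. c0 * norm \<eta> powr p - a0 x \<le> f x \<eta> \<and> f x \<eta> \<le> c1 * norm \<eta> powr p + a1 x)}"

definition nonneg_L1 :: "(real^'n::finite) set \<Rightarrow> (real^'n \<Rightarrow> real) \<Rightarrow> bool" where
  "nonneg_L1 \<Omega> a \<longleftrightarrow> integrable (lebesgue_on \<Omega>) a \<and> (AE x in lebesgue_on \<Omega>. 0 \<le> a x)"

definition ess_bounded :: "(real^'n::finite) set \<Rightarrow> (real^'n \<Rightarrow> real) \<Rightarrow> bool" where
  "ess_bounded \<Omega> a \<longleftrightarrow> a \<in> borel_measurable (lebesgue_on \<Omega>) \<and> (\<exists>M. AE x in lebesgue_on \<Omega>. \<bar>a x\<bar> \<le> M)"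

definition caratheodory :: "(real^'n::finite) set \<Rightarrow> (real^'n \<Rightarrow> real \<Rightarrow> real) \<Rightarrow> bool" where
  "caratheodory \<Omega> g \<longleftrightarrow>
     (\<forall>s. (\<lambda>x. g x s) \<in> borel_measurable (lebesgue_on \<Omega>)) \<and>
     (AE x in lebesgue_on \<Omega>. continuous_on UNIV (g x))"

definition energy ::
  "('m::finite \<Rightarrow> real^'n \<Rightarrow> real^'n) \<Rightarrow> (real^'n) set \<Rightarrow> (real^'n \<Rightarrow> real^'m \<Rightarrow> real) \<Rightarrow>
     (real^'n \<Rightarrow> real) \<Rightarrow> real" where
  "energy X \<Omega> f u = (LINT x|lebesgue_on \<Omega>. f x (Xgrad X \<Omega> u x))"

definition lower_order ::
  "(real^'n::finite) set \<Rightarrow> (real^'n \<Rightarrow> real \<Rightarrow> real) \<Rightarrow> (real^'n \<Rightarrow> real) \<Rightarrow> real" where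
  "lower_order \<Omega> g u = (LINT x|lebesgue_on \<Omega>. g x (u x))"

end

theory Submission
  imports Defs
begin

text \<open>
  The upper bound holds along constant sequences. For almost every \<open>x\<close> the functions
  \<open>fh h x\<close> are convex and satisfy the same bounds of growth \<open>p\<close>, so they are Lipschitz continuous on
  balls uniformly in \<open>h\<close>; their pointwise convergence on a countable dense set is therefore
  convergence everywhere, and \<open>F\<^sub>h u \<longlonglongrightarrow> F u\<close> by dominated convergence.

  For the lower bound, a weak neighbourhood of \<open>u\<close> that serves all large \<open>h\<close> at once is needed. The
  weak topology need not be metrizable on the whole space, so sequences do not suffice; convexity
  supplies the neighbourhood directly. Fix \<open>x\<close> and put \<open>\<eta>\<^sub>0 = Xu(x)\<close>. An affine minorant of \<open>f x\<close>
  that is almost exact at \<open>\<eta>\<^sub>0\<close> lies, up to a small error, below \<open>fh h x\<close> for all large \<open>h\<close>: on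
  a large ball by uniform convergence, outside it because \<open>fh h x\<close> grows faster than linearly,
  uniformly in \<open>h\<close> (\<open>eventually_affine_minorant\<close>). Its slope can be taken from a fixed countable
  dense set, so on a set of nearly full measure one threshold for \<open>h\<close> and finitely many slopes
  suffice, and choosing at each point the first admissible slope makes it a bounded measurable
  function \<open>\<xi>\<close> of \<open>x\<close>. Integration gives
  \<open>F\<^sub>h v \<ge> F u + \<integral> \<xi> \<bullet> (Xv - Xu) - \<epsilon>\<close> for all large \<open>h\<close> and all \<open>v\<close>
  (\<open>uniform_affine_minorant\<close>). Since \<open>v \<mapsto> \<integral> \<xi> \<bullet> Xv\<close> is a continuous linear functional, the set on
  which it is greater than its value at \<open>u\<close> minus \<open>\<epsilon>\<close> is the required neighbourhood.

  That this functional is linear rests on the uniqueness almost everywhere of the weak gradient,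
  that is, on the fundamental lemma of the calculus of variations. The required test functions
  are built from \<open>exp (-1/t)\<close>.

  For the perturbed functionals, coercivity of \<open>F\<^sub>h + G\<close> reduces the lower bound to norm-bounded
  sets. There the compact embedding makes \<open>G\<close> weakly lower semicontinuous: the integrals over the
  countably many rational boxes determine a function, so a sequence of counterexamples to lower
  semicontinuity in shrinking weak neighbourhoods defined by these integrals would have a
  subsequence that tends to \<open>u\<close> in \<open>L\<^sup>p\<close> and almost everywhere, and Fatou's lemma excludes this
  (\<open>lower_order_weakly_lsc_on_bounded\<close>).
\<close>

section \<open>Functions determined by their integrals over rational boxes\<close>

text \<open>
  The rational boxes are a countable generator of the Borel sets that is closed under
  intersections; countability lets their integrals define a sequence of weak neighbourhoods.
\<close>

definition rat_boxes :: "'a::euclidean_space set set" where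
  "rat_boxes = {box a b | a b. \<forall>i\<in>Basis. a \<bullet> i \<in> \<rat> \<and> b \<bullet> i \<in> \<rat>}"

lemma rat_boxesI: "(\<And>i. i \<in> Basis \<Longrightarrow> a \<bullet> i \<in> \<rat>) \<Longrightarrow> (\<And>i. i \<in> Basis \<Longrightarrow> b \<bullet> i \<in> \<rat>) \<Longrightarrow> box a b \<in> rat_boxes"
  unfolding rat_boxes_def by blast

lemma countable_rat_boxes: "countable (rat_boxes :: 'a::euclidean_space set set)"
proof -
  define R where "R = {a::'a. \<forall>i\<in>Basis. a \<bullet> i \<in> \<rat>}"
  have "R \<subseteq> (\<lambda>f. \<Sum>i\<in>Basis. f i *\<^sub>R i) ` (Basis \<rightarrow>\<^sub>E \<rat>)"
  proof
    fix a assume "a \<in> R"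
    then have "(\<lambda>i\<in>Basis. a \<bullet> i) \<in> Basis \<rightarrow>\<^sub>E \<rat>" unfolding R_def by auto
    moreover have "(\<Sum>i\<in>Basis. (\<lambda>i\<in>Basis. a \<bullet> i) i *\<^sub>R i) = a"
      using euclidean_representation[of a] by (simp cong: sum.cong)
    ultimately show "a \<in> (\<lambda>f. \<Sum>i\<in>Basis. f i *\<^sub>R i) ` (Basis \<rightarrow>\<^sub>E \<rat>)"
      by (intro image_eqI[where x = "\<lambda>i\<in>Basis. a \<bullet> i"]) (rule sym)
  qed
  moreover have "countable (Basis \<rightarrow>\<^sub>E \<rat> :: ('a \<Rightarrow> real) set)"
    by (intro countable_PiE countable_rat) simp
  ultimately have "countable R"
    by (meson countable_image countable_subset)
  moreover have "rat_boxes = (\<lambda>(a, b). box a b) ` (R \<times> R)"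
    unfolding rat_boxes_def R_def by (auto simp: image_iff)
  ultimately show ?thesis
    by (metis countable_SIGMA countable_image)
qed

lemma Int_stable_rat_boxes: "Int_stable rat_boxes"
proof (rule Int_stableI)
  fix A B :: "'a set" assume "A \<in> rat_boxes" "B \<in> rat_boxes"
  then obtain a b c d where *: "A = box a b" "B = box c d"
    and rat: "\<forall>i\<in>Basis. a \<bullet> i \<in> \<rat> \<and> b \<bullet> i \<in> \<rat>" "\<forall>i\<in>Basis. c \<bullet> i \<in> \<rat> \<and> d \<bullet> i \<in> \<rat>"
    unfolding rat_boxes_def by blast
  show "A \<inter> B \<in> rat_boxes"
  proof -
    have "max (a \<bullet> i) (c \<bullet> i) \<in> \<rat>" "min (b \<bullet> i) (d \<bullet> i) \<in> \<rat>" if "i \<in> Basis" for i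
      using rat that by (auto simp: max_def min_def)
    then show ?thesis
      unfolding * box_Int_box by (intro rat_boxesI) simp_all
  qed
qed

lemma borel_eq_rat_boxes: "sets (borel :: 'a::euclidean_space measure) = sigma_sets UNIV rat_boxes"
proof -
  have "borel = sigma UNIV (rat_boxes :: 'a set set)"
  proof (rule borel_eq_sigmaI1[OF borel_def, where F = "\<lambda>x. x" and A = rat_boxes, unfolded image_ident])
    fix M :: "'a set" assume "M \<in> {S. open S}"
    then have M: "open M" by simp
    show "M \<in> sets (sigma UNIV rat_boxes)"
    proof -
      have "\<exists>Q\<in>rat_boxes. x \<in> Q \<and> Q \<subseteq> M" if x: "x \<in> M" for x
      proof -
        obtain e where e: "e > 0" "ball x e \<subseteq> M" using openE[OF M x] .
        moreover from rational_boxes[OF e(1), of x] obtain a b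
          where "\<forall>i\<in>Basis. a \<bullet> i \<in> \<rat> \<and> b \<bullet> i \<in> \<rat>" "x \<in> box a b" "box a b \<subseteq> ball x e"
          by (elim exE conjE)
        ultimately show ?thesis by (intro bexI[of _ "box a b"] rat_boxesI) auto
      qed
      then have "M = \<Union>{Q \<in> rat_boxes. Q \<subseteq> M}" by blast
      moreover have "\<Union>{Q \<in> rat_boxes. Q \<subseteq> M} \<in> sets (sigma UNIV rat_boxes)"
        by (intro sets.countable_Union countable_subset[OF _ countable_rat_boxes]) auto
      ultimately show ?thesis by simp
    qed
  next
    fix Q :: "'a set" assume "Q \<in> rat_boxes"
    then show "Q \<in> sets borel" unfolding rat_boxes_def by force
  qed
  then have "sets (borel :: 'a measure) = sets (sigma UNIV (rat_boxes :: 'a set set))"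
    by (rule arg_cong)
  then show ?thesis by simp
qed

text \<open>
  Dynkin's lemma extends the hypothesis from the boxes to all Borel sets, and completion to all
  Lebesgue measurable sets.
\<close>

lemma AE_zero_if_integral_rat_boxes_zero:
  fixes W :: "'a::euclidean_space \<Rightarrow> real"
  assumes W: "integrable lebesgue W"
    and box: "\<And>Q. Q \<in> rat_boxes \<Longrightarrow> (LINT x:Q|lebesgue. W x) = 0"
  shows "AE x in lebesgue. W x = 0"
proof -
  have si: "set_integrable lebesgue A W" if "A \<in> sets lebesgue" for A
    using integrable_mult_indicator[OF that W] unfolding set_integrable_def .
  \<comment> \<open>The whole space is the increasing union of the cubes \<open>Q n\<close>; the step for complements needs it.\<close>
  have whole: "(LINT x|lebesgue. W x) = 0"
  proof -
    define Q where "Q n = box (- (\<Sum>i\<in>Basis. real n *\<^sub>R i)) (\<Sum>i\<in>Basis. real n *\<^sub>R i :: 'a)" for n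
    have Q: "Q n \<in> rat_boxes" for n
      unfolding Q_def by (intro rat_boxesI) (simp_all add: inner_sum_left inner_Basis if_distrib sum.delta cong: if_cong)
    have "(\<lambda>n. LINT x|lebesgue. indicator (Q n) x *\<^sub>R W x) \<longlonglongrightarrow> (LINT x|lebesgue. W x)"
    proof (rule integral_dominated_convergence[where w="\<lambda>x. norm (W x)"])
      show "AE x in lebesgue. (\<lambda>n. indicator (Q n) x *\<^sub>R W x) \<longlonglongrightarrow> W x"
      proof (rule AE_I2)
        fix x :: 'a
        obtain N :: nat where N: "norm x < real N" using reals_Archimedean2 by blast
        have "x \<in> Q n" if "n \<ge> N" for n
        proof -
          have "\<bar>x \<bullet> i\<bar> < real n" if "i \<in> Basis" for i
            using Basis_le_norm[OF that, of x] N \<open>n \<ge> N\<close> by linarith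
          then show ?thesis
            unfolding Q_def mem_box
            by (auto simp: inner_sum_left inner_Basis if_distrib sum.delta abs_less_iff minus_less_iff cong: if_cong)
        qed
        then have "eventually (\<lambda>n. indicator (Q n) x *\<^sub>R W x = W x) sequentially"
          unfolding eventually_sequentially by (intro exI[of _ N]) auto
        then show "(\<lambda>n. indicator (Q n) x *\<^sub>R W x) \<longlonglongrightarrow> W x"
          by (rule tendsto_eventually)
      qed
      show "(\<lambda>x. indicator (Q n) x *\<^sub>R W x) \<in> borel_measurable lebesgue" for n
        using si[of "Q n"] unfolding set_integrable_def Q_def by auto
    qed (use W in \<open>auto simp: indicator_def\<close>)
    moreover have "(LINT x|lebesgue. indicator (Q n) x *\<^sub>R W x) = 0" for n
      using box[OF Q] unfolding set_lebesgue_integral_def .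
    ultimately show ?thesis
      by (simp add: LIMSEQ_const_iff)
  qed
  have borel: "(LINT x:A|lebesgue. W x) = 0" if "A \<in> sets borel" for A
  proof -
    have meas: "A \<in> sets lebesgue" if "A \<in> sigma_sets UNIV rat_boxes" for A :: "'a set"
      using that unfolding borel_eq_rat_boxes[symmetric] by simp
    have "rat_boxes \<subseteq> Pow UNIV" by simp
    have "A \<in> sigma_sets UNIV rat_boxes" using that unfolding borel_eq_rat_boxes .
    from Int_stable_rat_boxes \<open>rat_boxes \<subseteq> Pow UNIV\<close> this
    show ?thesis
    proof (induction rule: sigma_sets_induct_disjoint)
      case (basic A) then show ?case by (rule box)
    next
      case empty then show ?case by (simp add: set_lebesgue_integral_def)
    next
      case (compl A)
      then have A: "A \<in> sets lebesgue" by (intro meas)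
      have "(LINT x:A \<union> (UNIV - A)|lebesgue. W x) = (LINT x:A|lebesgue. W x) + (LINT x:(UNIV - A)|lebesgue. W x)"
        using A by (intro set_integral_Un si) auto
      then show ?case
        using whole compl by (simp add: set_lebesgue_integral_def)
    next
      case (union A)
      then have A: "A i \<in> sets lebesgue" for i by (intro meas) auto
      have "(LINT x:(\<Union>i. A i)|lebesgue. W x) = (\<Sum>i. LINT x:A i|lebesgue. W x)"
        by (rule lebesgue_integral_countable_add)
          (use A union(1) in \<open>auto simp: disjoint_family_on_def intro!: si\<close>)
      then show ?case by (simp only: union.IH suminf_zero)
    qed
  qed
  have "(LINT x:A|lebesgue. W x) = 0" if A: "A \<in> sets lebesgue" for A
  proof -
    obtain S N N' where S: "A = S \<union> N" "N \<subseteq> N'" "N' \<in> null_sets lborel" "S \<in> sets lborel"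
      using completionE[OF A[unfolded sets_completion]] .
    have "(LINT x:A|lebesgue. W x) = (LINT x:S|lebesgue. W x)"
    proof -
      have "AE x in lebesgue. x \<notin> N'"
        using AE_not_in[OF null_sets_completionI[OF S(3)]] .
      moreover have "(x \<in> S) = (x \<in> A)" if "x \<notin> N'" for x
        unfolding S(1) using S(2) that by blast
      ultimately have ae: "AE x in lebesgue. (x \<in> S) = (x \<in> A)"
        by (rule eventually_mono)
      have meas: "set_borel_measurable lebesgue A W"  "set_borel_measurable lebesgue S W"
        using si[OF A] si[of S] S(4) by (simp_all add: set_borel_measurable_def set_integrable_def)
      show ?thesis by (rule set_integral_cong_set[OF meas(2,1) ae])
    qed
    then show ?thesis using borel[of S] S(4) by simp
  qed
  then show ?thesis
    using density_unique_real[OF W, of "\<lambda>_. 0"] by simp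
qed

section \<open>Smooth test functions and the fundamental lemma of the calculus of variations\<close>

text \<open>
  The powers of \<open>1 / t\<close> are included because they appear in the derivatives of \<open>exp (- (1 / t))\<close>:
  the span of these functions is closed under differentiation.
\<close>

definition flat :: "nat \<Rightarrow> real \<Rightarrow> real" where
  "flat n t = (if t \<le> 0 then 0 else (1 / t) ^ n * exp (- (1 / t)))"

lemma flat_nonneg: "0 \<le> flat n t"
  by (simp add: flat_def)

lemma flat_0_le_1: "flat 0 t \<le> 1"
  by (simp add: flat_def)

lemma flat_pos_iff: "0 < flat n t \<longleftrightarrow> 0 < t"
  by (simp add: flat_def)

text \<open>
  In the variable \<open>s = 1 / t\<close> this is the limit of \<open>s ^ n / exp s\<close> at infinity. Applied to
  \<open>n + 1\<close> it says that \<open>flat n\<close> has derivative zero at the origin.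
\<close>

lemma flat_tendsto_0: "(flat n \<longlongrightarrow> 0) (at 0)"
proof -
  have "((\<lambda>t. (1 / t) ^ n / exp (1 / t)) \<longlongrightarrow> 0) (at_right (0::real))"
    by (rule filterlim_compose[OF tendsto_power_div_exp_0])
       (simp add: filterlim_inverse_at_top_right divide_inverse)
  then have "(flat n \<longlongrightarrow> 0) (at_right 0)"
    by (rule Lim_transform_eventually)
       (auto simp: eventually_at_right_field flat_def exp_minus field_simps intro!: exI[of _ 1])
  moreover have "(flat n \<longlongrightarrow> 0) (at_left 0)"
    by (rule Lim_transform_eventually[OF tendsto_const])
       (auto simp: eventually_at_left_field flat_def intro!: exI[of _ "- 1"])
  ultimately show ?thesis
    by (simp add: filterlim_split_at)
qed

lemma DERIV_flat: "(flat n has_real_derivative (flat (n + 2) t - real n * flat (n + 1) t)) (at t)"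
proof (cases t "0::real" rule: linorder_cases)
  case less
  have "((\<lambda>_. 0) has_real_derivative (flat (n + 2) t - real n * flat (n + 1) t)) (at t)"
    using less by (simp add: flat_def)
  then show ?thesis
    by (rule has_field_derivative_transform_within_open[where S = "{..<0}"])
       (use less in \<open>auto simp: flat_def\<close>)
next
  case equal
  have "((\<lambda>h. (flat n (0 + h) - flat n 0) / h) \<longlongrightarrow> 0) (at 0)"
    by (rule Lim_transform_eventually[OF flat_tendsto_0[of "Suc n"]])
       (auto simp: flat_def eventually_at_filter)
  then show ?thesis
    using equal by (simp add: DERIV_def flat_def)
next
  case greater
  have "((\<lambda>t. (1 / t) ^ n * exp (- (1 / t))) has_real_derivative
      (flat (n + 2) t - real n * flat (n + 1) t)) (at t)"
  proof -
    have inv: "((\<lambda>t. 1 / t) has_real_derivative - ((1 / t) ^ 2)) (at t)"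
      using greater by (auto intro!: derivative_eq_intros simp: power2_eq_square)
    have "real n * (1 / t) ^ (n - 1) * (1 / t)\<^sup>2 = real n * (1 / t) ^ (n + 1)"
      by (cases n) (simp_all add: power2_eq_square)
    then show ?thesis
      using greater
      by (intro DERIV_cong[OF DERIV_mult[OF DERIV_power[OF inv, of n] DERIV_fun_exp[OF DERIV_minus[OF inv]]]])
        (simp add: flat_def algebra_simps power_add power2_eq_square)
  qed
  then show ?thesis
    by (rule has_field_derivative_transform_within_open[where S = "{0<..}"])
       (use greater in \<open>auto simp: flat_def\<close>)
qed

text \<open>
  An algebra of functions that contains the partial derivatives of its members consists of
  smooth functions, by induction on the order of differentiability. Its members vanish outside a
  box whenever they have a suitable factor \<open>flat n\<close>.
\<close>

inductive bump_algebra :: "(real^'n::finite \<Rightarrow> real) \<Rightarrow> bool" where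
  const: "bump_algebra (\<lambda>x. c)"
| flat: "bump_algebra (\<lambda>x. flat n (s * x $ i + c))"
| add: "bump_algebra f \<Longrightarrow> bump_algebra g \<Longrightarrow> bump_algebra (\<lambda>x. f x + g x)"
| mult: "bump_algebra f \<Longrightarrow> bump_algebra g \<Longrightarrow> bump_algebra (\<lambda>x. f x * g x)"

lemma bump_algebra_prod:
  assumes "finite I" "\<And>i. i \<in> I \<Longrightarrow> bump_algebra (f i)"
  shows "bump_algebra (\<lambda>x. \<Prod>i\<in>I. f i x)"
  using assms by (induction rule: finite_induct) (auto intro: bump_algebra.intros)

lemma bump_algebra_diff:
  assumes "bump_algebra f" "bump_algebra g"
  shows "bump_algebra (\<lambda>x. f x - g x)"
  using bump_algebra.add[OF assms(1) bump_algebra.mult[OF bump_algebra.const[of "-1"] assms(2)]]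
  by simp

lemma bump_algebra_power:
  assumes "bump_algebra f"
  shows "bump_algebra (\<lambda>x. f x ^ k)"
  using assms by (induction k) (auto intro: bump_algebra.intros)

lemma bump_algebra_derivative:
  fixes f :: "real^'n::finite \<Rightarrow> real"
  assumes "bump_algebra f"
  shows "\<exists>g. (\<forall>i. bump_algebra (g i)) \<and> (\<forall>x. (f has_derivative (\<lambda>h. \<Sum>i\<in>UNIV. g i x * h $ i)) (at x))"
  using assms
proof induction
  case (const c)
  show ?case
    by (rule exI[of _ "\<lambda>_ _. 0"]) (auto intro: bump_algebra.const)
next
  case (flat n s i c)
  define d where "d x = s * (flat (n + 2) (s * x $ i + c) - real n * flat (n + 1) (s * x $ i + c))" for x :: "real^'n"
  define g where "g j = (if j = i then d else (\<lambda>_. 0))" for j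
  have d: "bump_algebra d"
    unfolding d_def
    by (intro bump_algebra.mult bump_algebra_diff bump_algebra.const bump_algebra.flat)
  have "((\<lambda>x. flat n (s * x $ i + c)) has_derivative (\<lambda>h. \<Sum>j\<in>UNIV. g j x * h $ j)) (at x)" for x
  proof -
    have lin: "((\<lambda>x. s * x $ i + c) has_derivative (\<lambda>h. s * h $ i)) (at x)"
      by (rule bounded_linear.has_derivative[OF bounded_linear_vec_nth has_derivative_ident, THEN has_derivative_mult_right, THEN has_derivative_add_const])
    have "((\<lambda>x. flat n (s * x $ i + c)) has_derivative
        (\<lambda>h. (s * h $ i) * (flat (n + 2) (s * x $ i + c) - real n * flat (n + 1) (s * x $ i + c)))) (at x)"
      by (rule DERIV_compose_FDERIV[OF DERIV_flat lin])
    moreover have "(\<lambda>h. \<Sum>j\<in>UNIV. g j x * h $ j) =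
        (\<lambda>h. (s * h $ i) * (flat (n + 2) (s * x $ i + c) - real n * flat (n + 1) (s * x $ i + c)))"
    proof
      fix h :: "real^'n"
      have "(\<Sum>j\<in>UNIV. g j x * h $ j) = (\<Sum>j\<in>UNIV. if j = i then d x * h $ i else 0)"
        by (intro sum.cong) (auto simp: g_def)
      then show "(\<Sum>j\<in>UNIV. g j x * h $ j) =
        (s * h $ i) * (flat (n + 2) (s * x $ i + c) - real n * flat (n + 1) (s * x $ i + c))"
        by (simp add: d_def)
    qed
    ultimately show ?thesis by simp
  qed
  moreover have "bump_algebra (g j)" for j
    using d by (simp add: g_def bump_algebra.const)
  ultimately show ?case by blast
next
  case (add f g)
  from add.IH(1) obtain f' where f': "\<And>i. bump_algebra (f' i)" "\<And>x. (f has_derivative (\<lambda>h. \<Sum>i\<in>UNIV. f' i x * h $ i)) (at x)"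
    by blast
  from add.IH(2) obtain g' where g': "\<And>i. bump_algebra (g' i)" "\<And>x. (g has_derivative (\<lambda>h. \<Sum>i\<in>UNIV. g' i x * h $ i)) (at x)"
    by blast
  have "((\<lambda>x. f x + g x) has_derivative (\<lambda>h. \<Sum>i\<in>UNIV. (f' i x + g' i x) * h $ i)) (at x)" for x
    using has_derivative_add[OF f'(2) g'(2), of x] by (simp add: distrib_right sum.distrib)
  then show ?case
    using f'(1) g'(1) by (intro exI[of _ "\<lambda>i x. f' i x + g' i x"]) (auto intro: bump_algebra.add)
next
  case (mult f g)
  from mult.IH(1) obtain f' where f': "\<And>i. bump_algebra (f' i)" "\<And>x. (f has_derivative (\<lambda>h. \<Sum>i\<in>UNIV. f' i x * h $ i)) (at x)"
    by blast
  from mult.IH(2) obtain g' where g': "\<And>i. bump_algebra (g' i)" "\<And>x. (g has_derivative (\<lambda>h. \<Sum>i\<in>UNIV. g' i x * h $ i)) (at x)"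
    by blast
  have "((\<lambda>x. f x * g x) has_derivative (\<lambda>h. \<Sum>i\<in>UNIV. (f x * g' i x + f' i x * g x) * h $ i)) (at x)" for x
  proof (rule has_derivative_eq_rhs[OF has_derivative_mult[OF f'(2) g'(2)]], rule ext)
    fix h :: "real^'n"
    show "f x * (\<Sum>i\<in>UNIV. g' i x * h $ i) + (\<Sum>i\<in>UNIV. f' i x * h $ i) * g x =
        (\<Sum>i\<in>UNIV. (f x * g' i x + f' i x * g x) * h $ i)"
      unfolding sum_distrib_left sum_distrib_right sum.distrib[symmetric]
      by (intro sum.cong) (auto simp: algebra_simps)
  qed
  then show ?case
    using f'(1) g'(1) mult.hyps
    by (intro exI[of _ "\<lambda>i x. f x * g' i x + f' i x * g x"]) (auto intro!: bump_algebra.add bump_algebra.mult[of f] bump_algebra.mult[of _ g])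
qed

lemma partial_deriv_eq:
  fixes f :: "real^'n::finite \<Rightarrow> real"
  assumes "(f has_derivative D) (at x)"
  shows "((\<lambda>t. f (x + t *\<^sub>R axis i 1)) has_real_derivative D (axis i 1)) (at 0)"
    and "partial_deriv i f x = D (axis i 1)"
proof -
  have "((\<lambda>t. x + t *\<^sub>R axis i 1) has_derivative (\<lambda>t. t *\<^sub>R axis i (1::real))) (at 0)"
    by (auto intro!: derivative_eq_intros)
  from diff_chain_at[OF this, of f D] assms
  have "((\<lambda>t. f (x + t *\<^sub>R axis i 1)) has_derivative (\<lambda>t. D (t *\<^sub>R axis i 1))) (at 0)"
    by (simp add: o_def)
  moreover have "(\<lambda>t. D (t *\<^sub>R axis i 1)) = (\<lambda>t. D (axis i 1) * t)"
    using linear_cmul[OF has_derivative_linear[OF assms]] by auto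
  ultimately show *: "((\<lambda>t. f (x + t *\<^sub>R axis i 1)) has_real_derivative D (axis i 1)) (at 0)"
    by (simp add: has_field_derivative_def)
  show "partial_deriv i f x = D (axis i 1)"
    unfolding partial_deriv_def using * by (rule DERIV_imp_deriv)
qed

lemma Ck_bump_algebra:
  fixes f :: "real^'n::finite \<Rightarrow> real"
  shows "bump_algebra f \<Longrightarrow> Ck k f"
proof (induction k arbitrary: f)
  case (0 f)
  then obtain g where "\<forall>x. (f has_derivative (\<lambda>h. \<Sum>i\<in>UNIV. g i x * h $ i)) (at x)"
    using bump_algebra_derivative by blast
  then show ?case
    by (auto intro!: continuous_at_imp_continuous_on dest: has_derivative_continuous)
next
  case (Suc k f)
  then obtain g where g: "\<And>i. bump_algebra (g i)" "\<And>x. (f has_derivative (\<lambda>h. \<Sum>i\<in>UNIV. g i x * h $ i)) (at x)"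
    using bump_algebra_derivative by blast
  have "partial_deriv i f = g i" for i
  proof
    fix x
    have "(\<Sum>j\<in>UNIV. g j x * axis i 1 $ j) = (\<Sum>j\<in>UNIV. if j = i then g i x else 0)"
      by (intro sum.cong) (auto simp: axis_def)
    then show "partial_deriv i f x = g i x"
      using partial_deriv_eq(2)[OF g(2)] by simp
  qed
  then show ?case
    using g Suc.IH by (auto simp: differentiable_def)
qed

text \<open>
  A product of functions \<open>flat 0\<close> gives \<open>\<phi>\<close> with values in \<open>[0, 1]\<close>, positive exactly in the
  box; then \<open>1 - (1 - \<phi>)^k\<close> tends to the indicator function of the box.
\<close>

lemma smooth_approximation_of_box:
  fixes a b :: "real^'n::finite"
  shows "\<exists>\<psi> :: nat \<Rightarrow> real^'n \<Rightarrow> real. (\<forall>k. bump_algebra (\<psi> k)) \<and> (\<forall>k x. \<bar>\<psi> k x\<bar> \<le> 1) \<and>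
    (\<forall>k x. x \<notin> box a b \<longrightarrow> \<psi> k x = 0) \<and> (\<forall>x. (\<lambda>k. \<psi> k x) \<longlonglongrightarrow> indicator (box a b) x)"
proof -
  define \<phi> where "\<phi> x = (\<Prod>i\<in>UNIV. flat 0 (1 * x $ i + - a $ i) * flat 0 (-1 * x $ i + b $ i))" for x
  define \<psi> where "\<psi> k x = 1 - (1 - \<phi> x) ^ k" for k :: nat and x
  have range: "0 \<le> \<phi> x" "\<phi> x \<le> 1" for x
    unfolding \<phi>_def by (auto intro!: prod_nonneg prod_le_1 mult_le_one simp: flat_nonneg flat_0_le_1)
  have out: "\<phi> x = 0" if "x \<notin> box a b" for x
  proof -
    obtain i where "\<not> (a $ i < x $ i \<and> x $ i < b $ i)" using \<open>x \<notin> box a b\<close> unfolding mem_box_cart by blast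
    then have "flat 0 (1 * x $ i + - a $ i) * flat 0 (-1 * x $ i + b $ i) = 0"
      by (auto simp: flat_def)
    then show ?thesis unfolding \<phi>_def by (intro prod_zero) auto
  qed
  have inside: "0 < \<phi> x" if "x \<in> box a b" for x
    using that unfolding mem_box_cart \<phi>_def by (intro prod_pos) (auto simp: flat_pos_iff)
  show ?thesis
  proof (intro exI[of _ \<psi>] conjI allI impI)
    show "bump_algebra (\<psi> k)" for k
      unfolding \<psi>_def \<phi>_def
      by (intro bump_algebra_diff bump_algebra_power bump_algebra_prod bump_algebra.mult
          bump_algebra.const bump_algebra.flat finite)
    show "\<bar>\<psi> k x\<bar> \<le> 1" for k x
      using range[of x] power_le_one[of "1 - \<phi> x" k] zero_le_power[of "1 - \<phi> x" k] unfolding \<psi>_def by linarith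
    show "\<psi> k x = 0" if "x \<notin> box a b" for k x
      using out[OF that] by (simp add: \<psi>_def)
    show "(\<lambda>k. \<psi> k x) \<longlonglongrightarrow> indicator (box a b) x" for x
    proof (cases "x \<in> box a b")
      case True
      have "(\<lambda>k. 1 - (1 - \<phi> x) ^ k) \<longlonglongrightarrow> 1 - 0"
        using inside[OF True] range(2)[of x] by (intro tendsto_intros LIMSEQ_power_zero) auto
      then show ?thesis using True by (simp add: \<psi>_def)
    qed (simp add: \<psi>_def out)
  qed
qed

text \<open>
  Testing with the smooth approximations of the indicator function of a box shows that the
  integral of \<open>w\<close> over every box compactly contained in \<open>\<Omega>\<close> is zero, and \<open>\<Omega>\<close> is covered by
  countably many of these.
\<close>

lemma fundamental_lemma_calculus_of_variations:
  fixes w :: "real^'n::finite \<Rightarrow> real"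
  assumes \<Omega>: "open \<Omega>"
    and w: "\<And>K. compact K \<Longrightarrow> K \<subseteq> \<Omega> \<Longrightarrow> integrable (lebesgue_on K) w"
    and zero: "\<And>\<psi>. \<psi> \<in> Cinfc \<Omega> \<Longrightarrow> (LINT x|lebesgue_on \<Omega>. w x * \<psi> x) = 0"
  shows "AE x in lebesgue_on \<Omega>. w x = 0"
proof -
  have int_cbox: "integrable lebesgue (\<lambda>x. if x \<in> cbox a b then w x else 0)" if "cbox a b \<subseteq> \<Omega>" for a b
    using w[OF compact_cbox that] by (simp add: Lebesgue_Measure.integrable_restrict_UNIV)
  have int_box: "set_integrable lebesgue (box a b) w" if "cbox a b \<subseteq> \<Omega>" for a b
  proof -
    have "integrable lebesgue (\<lambda>x. indicator (box a b) x *\<^sub>R (if x \<in> cbox a b then w x else 0))"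
      by (rule integrable_mult_indicator[OF _ int_cbox[OF that]]) simp
    moreover have "(\<lambda>x. indicator (box a b) x *\<^sub>R (if x \<in> cbox a b then w x else 0)) = (\<lambda>x. indicator (box a b) x *\<^sub>R w x)"
      using box_subset_cbox[of a b] by (intro ext) (auto simp: indicator_def)
    ultimately show ?thesis unfolding set_integrable_def by simp
  qed
  have box_zero: "(LINT x:box a b|lebesgue. w x) = 0" if ab: "cbox a b \<subseteq> \<Omega>" for a b
  proof -
    obtain \<psi> :: "nat \<Rightarrow> real^'n \<Rightarrow> real"
      where \<psi>_all: "\<forall>k. bump_algebra (\<psi> k)" "\<forall>k x. \<bar>\<psi> k x\<bar> \<le> 1" "\<forall>k x. x \<notin> box a b \<longrightarrow> \<psi> k x = 0"
        "\<forall>x. (\<lambda>k. \<psi> k x) \<longlonglongrightarrow> indicator (box a b) x"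
      using smooth_approximation_of_box[of a b] by (elim exE conjE)
    note \<psi> = \<psi>_all[rule_format]
    \<comment> \<open>Extension by zero gives an integrable majorant for all the products with \<open>\<psi> k\<close>.\<close>
    define w' where "w' x = (if x \<in> cbox a b then w x else 0)" for x
    have w': "integrable lebesgue w'" unfolding w'_def using int_cbox[OF ab] .
    have cont: "continuous_on UNIV (\<psi> k)" for k
      using Ck_bump_algebra[OF \<psi>(1)[of k], of 0] by simp
    have "\<psi> k \<in> Cinfc \<Omega>" for k
    proof -
      have "closure {x. \<psi> k x \<noteq> 0} \<subseteq> cbox a b"
        using \<psi>(3) box_subset_cbox[of a b] by (intro closure_minimal closed_cbox) blast
      then have "compact_support_in (\<psi> k) \<Omega>"
        unfolding compact_support_in_def compact_eq_bounded_closed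
        using ab bounded_subset[OF bounded_cbox] by blast
      then show ?thesis
        unfolding Cinfc_def using Ck_bump_algebra[OF \<psi>(1)] by simp
    qed
    then have zero': "(LINT x|lebesgue. w' x * \<psi> k x) = 0" for k
    proof -
      have "(LINT x|lebesgue. w' x * \<psi> k x) = (LINT x|lebesgue. (if x \<in> \<Omega> then w x * \<psi> k x else 0))"
        using \<psi>(3)[of _ k] ab box_subset_cbox[of a b]
        by (intro Bochner_Integration.integral_cong) (auto simp: w'_def)
      also have "\<dots> = (LINT x|lebesgue_on \<Omega>. w x * \<psi> k x)"
        using \<Omega> by (intro Lebesgue_Measure.integral_restrict_UNIV) simp
      also have "\<dots> = 0"
        by (rule zero) fact
      finally show ?thesis .
    qed
    have "(\<lambda>k. LINT x|lebesgue. w' x * \<psi> k x) \<longlonglongrightarrow> (LINT x|lebesgue. w' x * indicator (box a b) x)"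
    proof (rule integral_dominated_convergence[where w = "\<lambda>x. \<bar>w' x\<bar>"])
      show "AE x in lebesgue. (\<lambda>k. w' x * \<psi> k x) \<longlonglongrightarrow> w' x * indicator (box a b) x"
        by (intro AE_I2 tendsto_mult_left \<psi>(4))
      show "(\<lambda>x. w' x * \<psi> k x) \<in> borel_measurable lebesgue" for k
        using borel_measurable_integrable[OF w'] borel_measurable_continuous_onI[OF cont[of k]]
        by (intro borel_measurable_times) (auto simp: measurable_completion)
      show "AE x in lebesgue. norm (w' x * \<psi> k x) \<le> \<bar>w' x\<bar>" for k
        using \<psi>(2) by (intro AE_I2) (simp add: abs_mult mult_left_le)
      show "(\<lambda>x. w' x * indicator (box a b) x) \<in> borel_measurable lebesgue"
        using borel_measurable_integrable[OF w']
        by (intro borel_measurable_times borel_measurable_indicator) auto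
    qed (use w' in auto)
    then have "(LINT x|lebesgue. w' x * indicator (box a b) x) = 0"
      by (simp add: zero' LIMSEQ_const_iff)
    moreover have "(\<lambda>x. w' x * indicator (box a b) x) = (\<lambda>x. indicator (box a b) x *\<^sub>R w x)"
      using box_subset_cbox[of a b] by (intro ext) (auto simp: w'_def indicator_def)
    ultimately show ?thesis
      unfolding set_lebesgue_integral_def by simp
  qed
  have "AE x in lebesgue. x \<in> cbox a b \<longrightarrow> w x = 0" if ab: "cbox a b \<subseteq> \<Omega>" for a b
  proof -
    have "AE x in lebesgue. indicator (box a b) x *\<^sub>R w x = 0"
    proof (rule AE_zero_if_integral_rat_boxes_zero)
      show "integrable lebesgue (\<lambda>x. indicator (box a b) x *\<^sub>R w x)"
        using int_box[OF ab] unfolding set_integrable_def .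
      fix Q :: "(real^'n) set" assume "Q \<in> rat_boxes"
      then obtain c d where Q: "Q = box c d" unfolding rat_boxes_def by blast
      obtain e f where ef: "box c d \<inter> box a b = box e f" unfolding box_Int_box by blast
      have "(LINT x:Q|lebesgue. indicator (box a b) x *\<^sub>R w x) = (LINT x:box e f|lebesgue. w x)"
        unfolding set_lebesgue_integral_def Q ef[symmetric]
        by (intro Bochner_Integration.integral_cong) (auto simp: indicator_def)
      also have "\<dots> = 0"
      proof (cases "box e f = {}")
        case True
        then show ?thesis by (simp add: set_lebesgue_integral_def)
      next
        case False
        then have "cbox e f = closure (box e f)" by simp
        also have "\<dots> \<subseteq> cbox a b"
          using ef box_subset_cbox[of a b] by (intro closure_minimal closed_cbox) blast
        finally show ?thesis using ab by (intro box_zero) simp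
      qed
      finally show "(LINT x:Q|lebesgue. indicator (box a b) x *\<^sub>R w x) = 0" .
    qed
    moreover have "AE x in lebesgue. x \<notin> cbox a b - box a b"
      using negligible_frontier_interval[of a b] by (intro AE_not_in) (simp add: negligible_iff_null_sets)
    ultimately show ?thesis
      by eventually_elim (auto simp: indicator_def)
  qed
  note ae = this
  obtain \<D> where \<D>: "countable \<D>" "\<D> \<subseteq> Pow \<Omega>" "\<And>Q. Q \<in> \<D> \<Longrightarrow> \<exists>a b. Q = cbox a b" "\<Union>\<D> = \<Omega>"
    using open_countable_Union_open_cbox[OF \<Omega>] by blast
  have "AE x in lebesgue. \<forall>Q\<in>\<D>. x \<in> Q \<longrightarrow> w x = 0"
    using \<D>(2,3) ae by (intro AE_ball_countable' \<D>(1)) blast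
  then have "AE x in lebesgue. x \<in> \<Omega> \<longrightarrow> w x = 0"
    by eventually_elim (use \<D>(4) in blast)
  then show ?thesis
    using \<Omega> by (simp add: AE_restrict_space_iff)
qed

section \<open>Partial derivatives of Lipschitz functions\<close>

text \<open>
  Cauchy's criterion, with only the quantifiers over the natural numbers \<open>n\<close> and \<open>m\<close> outside the
  inequality. When \<open>q\<close> depends continuously on a parameter, the part inside them defines a closed set
  of parameters, so that the whole condition defines a Borel set.
\<close>

lemma limit_at_0_iff_quotient_Cauchy:
  fixes q :: "real \<Rightarrow> real"
  shows "(\<exists>l. (q \<longlongrightarrow> l) (at 0)) \<longleftrightarrow>
    (\<forall>n::nat. \<exists>m::nat. \<forall>s t. s \<noteq> 0 \<and> \<bar>s\<bar> < 1 / Suc m \<and> t \<noteq> 0 \<and> \<bar>t\<bar> < 1 / Suc m \<longrightarrow> \<bar>q s - q t\<bar> \<le> 1 / Suc n)"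
    (is "_ \<longleftrightarrow> ?C")
proof
  assume "\<exists>l. (q \<longlongrightarrow> l) (at 0)"
  then obtain l where l: "(q \<longlongrightarrow> l) (at 0)" ..
  show ?C
  proof
    fix n :: nat
    define e where "e = 1 / real (Suc n) / 2"
    have "e > 0" by (simp add: e_def)
    then obtain d where d: "d > 0" "\<forall>t. t \<noteq> 0 \<and> \<bar>t\<bar> < d \<longrightarrow> \<bar>q t - l\<bar> < e"
      using LIM_D[OF l, of e] by auto
    obtain m :: nat where m: "1 / real (Suc m) < d"
      using reals_Archimedean[OF d(1)] by (auto simp: inverse_eq_divide)
    have "\<bar>q s - q t\<bar> \<le> 1 / Suc n" if "s \<noteq> 0" "\<bar>s\<bar> < 1 / Suc m" "t \<noteq> 0" "\<bar>t\<bar> < 1 / Suc m" for s t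
    proof -
      have "\<bar>s\<bar> < d" "\<bar>t\<bar> < d" using that m by linarith+
      then have "\<bar>q s - l\<bar> < e" "\<bar>q t - l\<bar> < e"
        using d(2) that by blast+
      moreover have "e + e = 1 / Suc n" unfolding e_def by (rule field_sum_of_halves)
      ultimately show ?thesis by linarith
    qed
    then show "\<exists>m::nat. \<forall>s t. s \<noteq> 0 \<and> \<bar>s\<bar> < 1 / Suc m \<and> t \<noteq> 0 \<and> \<bar>t\<bar> < 1 / Suc m \<longrightarrow> \<bar>q s - q t\<bar> \<le> 1 / Suc n"
      by blast
  qed
next
  assume C: ?C
  define r where "r k = q (1 / real (Suc k))" for k
  have small: "1 / real (Suc k) < 1 / real (Suc m)" if "m < k" for k m :: nat
    using that by (simp add: frac_less2)
  have "Cauchy r"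
  proof (rule metric_CauchyI)
    fix e :: real assume "0 < e"
    then obtain n :: nat where n: "1 / real (Suc n) < e"
      using reals_Archimedean[of e] by (auto simp: inverse_eq_divide)
    from C[rule_format, of n] obtain m :: nat
      where "\<forall>s t. s \<noteq> 0 \<and> \<bar>s\<bar> < 1 / Suc m \<and> t \<noteq> 0 \<and> \<bar>t\<bar> < 1 / Suc m \<longrightarrow> \<bar>q s - q t\<bar> \<le> 1 / Suc n" ..
    then have "\<bar>r i - r j\<bar> \<le> 1 / Suc n" if "i > m" "j > m" for i j
      unfolding r_def using small that by auto
    then show "\<exists>M. \<forall>i\<ge>M. \<forall>j\<ge>M. dist (r i) (r j) < e"
      using n by (intro exI[of _ "Suc m"]) (auto simp: dist_real_def Suc_le_eq intro: le_less_trans)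
  qed
  then obtain l where l: "r \<longlonglongrightarrow> l"
    using Cauchy_convergent convergent_def by blast
  have "(q \<longlongrightarrow> l) (at 0)"
  proof (rule LIM_I)
    fix e :: real assume "0 < e"
    then obtain n :: nat where n: "1 / real (Suc n) < e"
      using reals_Archimedean[of e] by (auto simp: inverse_eq_divide)
    from C[rule_format, of n] obtain m :: nat
      where m: "\<forall>s t. s \<noteq> 0 \<and> \<bar>s\<bar> < 1 / Suc m \<and> t \<noteq> 0 \<and> \<bar>t\<bar> < 1 / Suc m \<longrightarrow> \<bar>q s - q t\<bar> \<le> 1 / Suc n" ..
    have "\<bar>q t - l\<bar> \<le> 1 / Suc n" if t: "t \<noteq> 0" "\<bar>t\<bar> < 1 / Suc m" for t
    proof (rule LIMSEQ_le_const2)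
      show "(\<lambda>k. \<bar>q t - r k\<bar>) \<longlonglongrightarrow> \<bar>q t - l\<bar>"
        by (intro tendsto_intros l)
      show "\<exists>N. \<forall>k\<ge>N. \<bar>q t - r k\<bar> \<le> 1 / Suc n"
        unfolding r_def using m t small by (intro exI[of _ "Suc m"]) (auto simp: Suc_le_eq)
    qed
    then show "\<exists>s>0. \<forall>x. x \<noteq> 0 \<and> norm (x - 0) < s \<longrightarrow> norm (q x - l) < e"
      using n by (intro exI[of _ "1 / real (Suc m)"]) (auto intro: le_less_trans)
  qed
  then show "\<exists>l. (q \<longlongrightarrow> l) (at 0)" ..
qed

text \<open>
  Where the derivative does not exist, \<open>deriv\<close> is a choice from the empty predicate, and hence a
  constant that depends neither on the function nor on the point. This keeps \<open>partial_deriv\<close> of a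
  continuous function measurable, and that of a Lipschitz continuous function bounded.
\<close>

lemma partial_deriv_cases:
  obtains l where "((\<lambda>t. f (x + t *\<^sub>R axis i 1)) has_real_derivative l) (at 0)" "partial_deriv i f x = l"
  | "\<nexists>l. ((\<lambda>t. f (x + t *\<^sub>R axis i 1)) has_real_derivative l) (at 0)"
    "partial_deriv i f x = (SOME l::real. False)"
proof (cases "\<exists>l. ((\<lambda>t. f (x + t *\<^sub>R axis i 1)) has_real_derivative l) (at 0)")
  case True
  then obtain l where "((\<lambda>t. f (x + t *\<^sub>R axis i 1)) has_real_derivative l) (at 0)" ..
  then show ?thesis
    using that(1) DERIV_imp_deriv unfolding partial_deriv_def by blast
next
  case False
  then show ?thesis
    using that(2) unfolding partial_deriv_def deriv_def by simp
qed

text \<open>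
  The distributional gradient is tested with partial derivatives of functions that are only
  Lipschitz continuous, and need not be continuous. The derivative is the limit of difference quotients
  on the set where the criterion above holds, and constant elsewhere.
\<close>

lemma borel_measurable_partial_deriv:
  fixes f :: "real^'n::finite \<Rightarrow> real"
  assumes f: "continuous_on UNIV f"
  shows "partial_deriv i f \<in> borel_measurable borel"
proof -
  define q where "q t x = (f (x + t *\<^sub>R axis i 1) - f x) / t" for t x
  have q: "continuous_on UNIV (q t)" if "t \<noteq> 0" for t
    unfolding q_def using that
    by (auto intro!: continuous_intros continuous_on_compose2[OF f])
  define S :: "nat \<Rightarrow> real set" where "S m = {t. t \<noteq> 0 \<and> \<bar>t\<bar> < 1 / Suc m}" for m
  define A where "A = (\<Inter>n::nat. \<Union>m. \<Inter>s\<in>S m. \<Inter>t\<in>S m. {x. \<bar>q s x - q t x\<bar> \<le> 1 / Suc n})"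
  have [measurable]: "A \<in> sets borel"
  proof -
    have "closed (\<Inter>s\<in>S m. \<Inter>t\<in>S m. {x. \<bar>q s x - q t x\<bar> \<le> 1 / Suc n})" for m n :: nat
      by (intro closed_INT ballI closed_Collect_le continuous_intros q) (auto simp: S_def)
    then show ?thesis
      unfolding A_def by (intro sets.countable_INT'' sets.countable_UN' borel_closed) auto
  qed
  have DERIV_iff: "((\<lambda>t. f (x + t *\<^sub>R axis i 1)) has_real_derivative l) (at 0) \<longleftrightarrow> ((\<lambda>t. q t x) \<longlongrightarrow> l) (at 0)" for x l
    by (simp add: DERIV_def q_def)
  have A_iff: "x \<in> A \<longleftrightarrow> (\<exists>l. ((\<lambda>t. q t x) \<longlongrightarrow> l) (at 0))" for x
    unfolding limit_at_0_iff_quotient_Cauchy A_def S_def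
    by (simp only: INT_iff UN_iff mem_Collect_eq Ball_def Bex_def UNIV_I simp_thms imp_conjL)
      (intro iff_allI iff_exI, blast)
  have eq: "partial_deriv i f x = (if x \<in> A then lim (\<lambda>k. q (1 / real (Suc k)) x) else (SOME l::real. False))" for x
  proof (cases rule: partial_deriv_cases[where f = f and x = x and i = i])
    case (1 l)
    then have l: "((\<lambda>t. q t x) \<longlongrightarrow> l) (at 0)" using DERIV_iff by blast
    have "(\<lambda>k. q (1 / real (Suc k)) x) \<longlonglongrightarrow> l"
    proof (rule filterlim_compose[OF l])
      have "(\<lambda>k. 1 / real (Suc k)) \<longlonglongrightarrow> 0"
        using LIMSEQ_inverse_real_of_nat by (simp add: inverse_eq_divide)
      then show "filterlim (\<lambda>k. 1 / real (Suc k)) (at 0) sequentially"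
        by (simp add: filterlim_at)
    qed
    then show ?thesis using 1 l A_iff limI by auto
  next
    case 2
    then show ?thesis using A_iff DERIV_iff by auto
  qed
  have [measurable]: "q (1 / real (Suc k)) \<in> borel_measurable borel" for k
    by (intro borel_measurable_continuous_onI q) simp
  show ?thesis
    unfolding eq[abs_def] by measurable
qed

text \<open>
  The product rule for difference quotients, with the quotient of the factor \<open>g\<close> bounded by its
  Lipschitz constant. The last summand covers the points where the derivative does not exist.
\<close>

lemma abs_partial_deriv_mult_le:
  fixes g \<psi> :: "real^'n::finite \<Rightarrow> real"
  assumes g: "L-lipschitz_on S g" and S: "open S" "x \<in> S" and \<psi>: "\<psi> differentiable (at x)"
  shows "\<bar>partial_deriv i (\<lambda>y. g y * \<psi> y) x\<bar> \<le> L * \<bar>\<psi> x\<bar> + \<bar>g x\<bar> * \<bar>partial_deriv i \<psi> x\<bar> + \<bar>SOME l::real. False\<bar>"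
proof -
  have L: "0 \<le> L" using g by (rule lipschitz_on_nonneg)
  show ?thesis
  proof (cases rule: partial_deriv_cases[where f = "\<lambda>y. g y * \<psi> y" and x = x and i = i])
    case (1 l)
    let ?e = "\<lambda>t::real. x + t *\<^sub>R axis i (1::real)"
    obtain D where D: "(\<psi> has_derivative D) (at x)" using \<psi> unfolding differentiable_def by blast
    have d\<psi>: "((\<lambda>t. (\<psi> (?e t) - \<psi> x) / t) \<longlongrightarrow> partial_deriv i \<psi> x) (at 0)"
      using partial_deriv_eq[OF D, of i] by (simp add: DERIV_def)
    have e: "(?e \<longlongrightarrow> x) (at 0)"
      by (auto intro!: tendsto_eq_intros)
    have \<psi>e: "((\<lambda>t. \<psi> (?e t)) \<longlongrightarrow> \<psi> x) (at 0)"
      using isCont_tendsto_compose[OF has_derivative_continuous[OF D] e] .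
    have dl: "((\<lambda>t. (g (?e t) * \<psi> (?e t) - g x * \<psi> x) / t) \<longlongrightarrow> l) (at 0)"
      using 1(1) by (simp add: DERIV_def)
    have "\<bar>l\<bar> \<le> L * \<bar>\<psi> x\<bar> + \<bar>g x\<bar> * \<bar>partial_deriv i \<psi> x\<bar>"
    proof (rule tendsto_le[OF _ _ tendsto_rabs[OF dl]])
      show "((\<lambda>t. L * \<bar>\<psi> (?e t)\<bar> + \<bar>g x\<bar> * \<bar>(\<psi> (?e t) - \<psi> x) / t\<bar>) \<longlongrightarrow>
          L * \<bar>\<psi> x\<bar> + \<bar>g x\<bar> * \<bar>partial_deriv i \<psi> x\<bar>) (at 0)"
        by (intro tendsto_intros d\<psi> \<psi>e)
      have "eventually (\<lambda>t. ?e t \<in> S) (at 0)"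
        using topological_tendstoD[OF e S] .
      moreover have "eventually (\<lambda>t::real. t \<noteq> 0) (at 0)"
        by (simp add: eventually_at_filter)
      ultimately show "eventually (\<lambda>t. \<bar>(g (?e t) * \<psi> (?e t) - g x * \<psi> x) / t\<bar> \<le>
          L * \<bar>\<psi> (?e t)\<bar> + \<bar>g x\<bar> * \<bar>(\<psi> (?e t) - \<psi> x) / t\<bar>) (at 0)"
      proof eventually_elim
        case (elim t)
        have "(g (?e t) * \<psi> (?e t) - g x * \<psi> x) / t =
            (g (?e t) - g x) / t * \<psi> (?e t) + g x * ((\<psi> (?e t) - \<psi> x) / t)"
          using elim(2) by (simp add: field_simps)
        moreover have "\<bar>(g (?e t) - g x) / t\<bar> * \<bar>\<psi> (?e t)\<bar> \<le> L * \<bar>\<psi> (?e t)\<bar>"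
        proof (rule mult_right_mono)
          have "\<bar>g (?e t) - g x\<bar> \<le> L * dist (?e t) x"
            using lipschitz_onD[OF g elim(1) S(2)] by (simp add: dist_real_def)
          also have "dist (?e t) x = \<bar>t\<bar>"
            by (simp add: dist_norm)
          finally show "\<bar>(g (?e t) - g x) / t\<bar> \<le> L" using elim(2) by (simp add: divide_le_eq)
        qed simp
        ultimately show ?case
          using abs_triangle_ineq[of "(g (?e t) - g x) / t * \<psi> (?e t)" "g x * ((\<psi> (?e t) - \<psi> x) / t)"]
          by (simp only: abs_mult)
      qed
    qed simp
    then show ?thesis using 1(2) by simp
  next
    case 2
    then show ?thesis using L by simp
  qed
qed

section \<open>Weak gradients along vector fields\<close>

locale sobolev_setting =
  fixes \<Omega> \<Omega>0 :: "(real^'n::finite) set"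
    and X :: "'m::finite \<Rightarrow> real^'n \<Rightarrow> real^'n"
    and p :: real
  assumes open_\<Omega>: "open \<Omega>" and bounded_\<Omega>: "bounded \<Omega>"
    and p: "1 < p"
    and open_\<Omega>0: "open \<Omega>0" and closure_\<Omega>: "closure \<Omega> \<subseteq> \<Omega>0"
    and Lipschitz: "\<forall>j. \<exists>L. L-lipschitz_on \<Omega>0 (X j)"
    and locally_Lipschitz: "\<forall>j x. \<exists>\<epsilon>>0. \<exists>L. L-lipschitz_on (ball x \<epsilon>) (X j)"
begin

lemma lmeasurable_\<Omega>: "\<Omega> \<in> lmeasurable"
  using open_\<Omega> bounded_\<Omega> by (simp add: lmeasurable_open)

lemma sets_\<Omega>: "\<Omega> \<in> sets lebesgue"
  using open_\<Omega> by simp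

sublocale finite_measure "lebesgue_on \<Omega>"
  by (rule finite_measure_lebesgue_on[OF lmeasurable_\<Omega>])

lemma abs_le_1_plus_powr: "t \<le> 1 + t powr p" if "0 \<le> t" for t :: real
proof (cases "t \<le> 1")
  case False
  then have "t powr 1 \<le> t powr p" using p by (intro powr_mono) auto
  then show ?thesis using False by simp
qed (simp add: add_increasing2)

lemma Lp_integrable:
  fixes u :: "real^'n \<Rightarrow> 'b::euclidean_space"
  assumes "u \<in> Lp p \<Omega>"
  shows "integrable (lebesgue_on \<Omega>) u"
proof (rule Bochner_Integration.integrable_bound)
  show "integrable (lebesgue_on \<Omega>) (\<lambda>x. 1 + norm (u x) powr p)"
    using assms by (auto simp: Lp_def)
  show "AE x in lebesgue_on \<Omega>. norm (u x) \<le> norm (1 + norm (u x) powr p)"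
  proof (rule AE_I2)
    fix x show "norm (u x) \<le> norm (1 + norm (u x) powr p)"
      using abs_le_1_plus_powr[of "norm (u x)"] by simp
  qed
qed (use assms in \<open>auto simp: Lp_def\<close>)

lemma continuous_X: "continuous_on UNIV (\<lambda>x. X j x $ i)"
proof -
  have "continuous (at x) (X j)" for x
  proof -
    obtain e L where "e > 0" "L-lipschitz_on (ball x e) (X j)" using locally_Lipschitz by blast
    then show ?thesis
      using lipschitz_on_continuous_on continuous_on_interior[of "ball x e" "X j" x] by auto
  qed
  then show ?thesis
    by (intro continuous_on_component continuous_at_imp_continuous_on) auto
qed

lemma bounded_on_\<Omega>:
  fixes f :: "real^'n \<Rightarrow> real"
  assumes "continuous_on UNIV f"
  obtains B where "0 \<le> B" "\<And>x. x \<in> \<Omega> \<Longrightarrow> \<bar>f x\<bar> \<le> B"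
proof -
  have "compact (f ` closure \<Omega>)"
    using bounded_\<Omega> continuous_on_subset[OF assms] by (intro compact_continuous_image) auto
  then obtain B where B: "\<forall>y \<in> f ` closure \<Omega>. norm y \<le> B"
    using compact_imp_bounded bounded_iff by blast
  have "\<bar>f x\<bar> \<le> \<bar>B\<bar>" if "x \<in> \<Omega>" for x
    using B that closure_subset[of \<Omega>] by force
  then show thesis using that[of "\<bar>B\<bar>"] by simp
qed

lemma Cinfc_D:
  assumes "\<psi> \<in> Cinfc \<Omega>"
  shows "continuous_on UNIV \<psi>" "\<psi> differentiable (at x)" "continuous_on UNIV (partial_deriv i \<psi>)"
proof -
  have "Ck 0 \<psi>" "Ck (Suc 0) \<psi>" using assms unfolding Cinfc_def by blast+
  then show "continuous_on UNIV \<psi>" "\<psi> differentiable (at x)" "continuous_on UNIV (partial_deriv i \<psi>)"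
    by simp_all
qed

text \<open>
  The integral on the right-hand side of the definition of the weak gradient is linear in \<open>u\<close>
  only because it converges.
\<close>

lemma integrable_test:
  assumes u: "integrable (lebesgue_on \<Omega>) u" and \<psi>: "\<psi> \<in> Cinfc \<Omega>"
  shows "integrable (lebesgue_on \<Omega>) (\<lambda>x. u x * (\<Sum>i\<in>UNIV. partial_deriv i (\<lambda>y. X j y $ i * \<psi> y) x))"
proof -
  have "integrable (lebesgue_on \<Omega>) (\<lambda>x. u x * partial_deriv i (\<lambda>y. X j y $ i * \<psi> y) x)" for i
  proof -
    obtain L where "L-lipschitz_on \<Omega>0 (X j)" using Lipschitz by blast
    then have L: "L-lipschitz_on \<Omega>0 (\<lambda>x. X j x $ i)"
      unfolding lipschitz_on_def by (blast intro: order_trans[OF dist_vec_nth_le])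
    obtain B1 where B1: "0 \<le> B1" "\<And>x. x \<in> \<Omega> \<Longrightarrow> \<bar>\<psi> x\<bar> \<le> B1"
      using bounded_on_\<Omega>[OF Cinfc_D(1)[OF \<psi>]] by blast
    obtain B2 where B2: "0 \<le> B2" "\<And>x. x \<in> \<Omega> \<Longrightarrow> \<bar>partial_deriv i \<psi> x\<bar> \<le> B2"
      using bounded_on_\<Omega>[OF Cinfc_D(3)[OF \<psi>]] by blast
    obtain B3 where B3: "0 \<le> B3" "\<And>x. x \<in> \<Omega> \<Longrightarrow> \<bar>X j x $ i\<bar> \<le> B3"
      using bounded_on_\<Omega>[OF continuous_X] by blast
    define B where "B = L * B1 + B3 * B2 + \<bar>SOME l::real. False\<bar>"
    have B: "\<bar>partial_deriv i (\<lambda>y. X j y $ i * \<psi> y) x\<bar> \<le> B" if x: "x \<in> \<Omega>" for x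
    proof -
      have "x \<in> \<Omega>0" using x closure_\<Omega> closure_subset by blast
      then have "\<bar>partial_deriv i (\<lambda>y. X j y $ i * \<psi> y) x\<bar>
          \<le> L * \<bar>\<psi> x\<bar> + \<bar>X j x $ i\<bar> * \<bar>partial_deriv i \<psi> x\<bar> + \<bar>SOME l::real. False\<bar>"
        using abs_partial_deriv_mult_le[OF L open_\<Omega>0 _ Cinfc_D(2)[OF \<psi>]] by blast
      also have "\<dots> \<le> B"
        unfolding B_def using B1 B2 B3 x lipschitz_on_nonneg[OF L]
        by (intro add_mono mult_mono order_refl) auto
      finally show ?thesis .
    qed
    have meas: "partial_deriv i (\<lambda>y. X j y $ i * \<psi> y) \<in> borel_measurable (lebesgue_on \<Omega>)"
      by (intro measurable_restrict_space1 measurable_completion)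
        (simp add: borel_measurable_partial_deriv continuous_on_mult[OF continuous_X Cinfc_D(1)[OF \<psi>]])
    show ?thesis
    proof (rule Bochner_Integration.integrable_bound)
      show "integrable (lebesgue_on \<Omega>) (\<lambda>x. B * \<bar>u x\<bar>)"
        using u by simp
      show "(\<lambda>x. u x * partial_deriv i (\<lambda>y. X j y $ i * \<psi> y) x) \<in> borel_measurable (lebesgue_on \<Omega>)"
        by (intro borel_measurable_times meas borel_measurable_integrable u)
      show "AE x in lebesgue_on \<Omega>. norm (u x * partial_deriv i (\<lambda>y. X j y $ i * \<psi> y) x) \<le> norm (B * \<bar>u x\<bar>)"
      proof (rule AE_I2)
        fix x assume "x \<in> space (lebesgue_on \<Omega>)"
        then have x: "x \<in> \<Omega>" by simp
        then have "0 \<le> B" using B abs_ge_zero order_trans by blast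
        then show "norm (u x * partial_deriv i (\<lambda>y. X j y $ i * \<psi> y) x) \<le> norm (B * \<bar>u x\<bar>)"
          using mult_left_mono[OF B[OF x], of "\<bar>u x\<bar>"] by (simp add: abs_mult mult.commute)
      qed
    qed
  qed
  then show ?thesis
    unfolding sum_distrib_left by (intro Bochner_Integration.integrable_sum)
qed

lemma integrable_mult_Cinfc:
  fixes w :: "real^'n \<Rightarrow> real"
  assumes w: "\<And>K. compact K \<Longrightarrow> K \<subseteq> \<Omega> \<Longrightarrow> integrable (lebesgue_on K) w" and \<psi>: "\<psi> \<in> Cinfc \<Omega>"
  shows "integrable (lebesgue_on \<Omega>) (\<lambda>x. w x * \<psi> x)"
proof -
  define K where "K = closure {x. \<psi> x \<noteq> 0}"
  have K: "compact K" "K \<subseteq> \<Omega>" using \<psi> by (auto simp: Cinfc_def compact_support_in_def K_def)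
  have "integrable (lebesgue_on K) w" using w K by blast
  then have wK: "integrable lebesgue (\<lambda>x. if x \<in> K then w x else 0)"
    using K by (simp add: Lebesgue_Measure.integrable_restrict_UNIV lmeasurable_compact fmeasurableD)
  obtain B where B: "\<And>x. x \<in> \<Omega> \<Longrightarrow> \<bar>\<psi> x\<bar> \<le> B" "0 \<le> B"
    using bounded_on_\<Omega>[OF Cinfc_D(1)[OF \<psi>]] by blast
  have zero: "\<psi> x = 0" if "x \<notin> K" for x using that closure_subset[of "{x. \<psi> x \<noteq> 0}"] unfolding K_def by blast
  have "integrable lebesgue (\<lambda>x. (if x \<in> K then w x else 0) * \<psi> x)"
  proof (rule Bochner_Integration.integrable_bound)
    show "integrable lebesgue (\<lambda>x. B * \<bar>if x \<in> K then w x else 0\<bar>)"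
      using wK by simp
    have "\<psi> \<in> borel_measurable lebesgue"
      using borel_measurable_continuous_onI[OF Cinfc_D(1)[OF \<psi>]] by (simp add: measurable_completion)
    then show "(\<lambda>x. (if x \<in> K then w x else 0) * \<psi> x) \<in> borel_measurable lebesgue"
      using borel_measurable_integrable[OF wK] by (intro borel_measurable_times)
    show "AE x in lebesgue. norm ((if x \<in> K then w x else 0) * \<psi> x) \<le> norm (B * \<bar>if x \<in> K then w x else 0\<bar>)"
    proof (rule AE_I2)
      fix x show "norm ((if x \<in> K then w x else 0) * \<psi> x) \<le> norm (B * \<bar>if x \<in> K then w x else 0\<bar>)"
      proof (cases "x \<in> K")
        case True
        then have "\<bar>\<psi> x\<bar> \<le> B" using B K by blast
        then show ?thesis using True B(2) mult_left_mono[of "\<bar>\<psi> x\<bar>" B "\<bar>w x\<bar>"]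
          by (simp add: abs_mult mult.commute)
      qed simp
    qed
  qed
  moreover have "(\<lambda>x. (if x \<in> K then w x else 0) * \<psi> x) = (\<lambda>x. if x \<in> \<Omega> then w x * \<psi> x else 0)"
    using zero K(2) by (intro ext) auto
  ultimately show ?thesis
    by (simp add: Lebesgue_Measure.integrable_restrict_UNIV sets_\<Omega>)
qed

lemma weak_Xgrad_integrable:
  assumes v: "is_weak_Xgrad X \<Omega> u v" and K: "compact K" "K \<subseteq> \<Omega>"
  shows "integrable (lebesgue_on K) (\<lambda>x. v x $ j)"
proof (rule integrable_bounded_linear[OF bounded_linear_vec_nth])
  show "integrable (lebesgue_on K) v" using v K unfolding is_weak_Xgrad_def by blast
qed

lemma is_weak_Xgrad_unique:
  assumes v: "is_weak_Xgrad X \<Omega> u v" and v': "is_weak_Xgrad X \<Omega> u v'"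
  shows "AE x in lebesgue_on \<Omega>. v x = v' x"
proof -
  have "AE x in lebesgue_on \<Omega>. v x $ j - v' x $ j = 0" for j
  proof (rule fundamental_lemma_calculus_of_variations[OF open_\<Omega>])
    fix \<psi> assume \<psi>: "\<psi> \<in> Cinfc \<Omega>"
    have "(LINT x|lebesgue_on \<Omega>. v x $ j * \<psi> x) = (LINT x|lebesgue_on \<Omega>. v' x $ j * \<psi> x)"
      using v v' \<psi> unfolding is_weak_Xgrad_def by simp
    moreover have "integrable (lebesgue_on \<Omega>) (\<lambda>x. v x $ j * \<psi> x)" "integrable (lebesgue_on \<Omega>) (\<lambda>x. v' x $ j * \<psi> x)"
      using integrable_mult_Cinfc[OF weak_Xgrad_integrable[OF v] \<psi>] integrable_mult_Cinfc[OF weak_Xgrad_integrable[OF v'] \<psi>] by auto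
    ultimately show "(LINT x|lebesgue_on \<Omega>. (v x $ j - v' x $ j) * \<psi> x) = 0"
      by (simp add: left_diff_distrib)
  qed (intro Bochner_Integration.integrable_diff weak_Xgrad_integrable[OF v] weak_Xgrad_integrable[OF v'])
  then have "AE x in lebesgue_on \<Omega>. \<forall>j. v x $ j - v' x $ j = 0"
    by (simp add: AE_all_countable)
  then show ?thesis by eventually_elim (simp add: vec_eq_iff)
qed

lemma is_weak_Xgrad_add:
  assumes v: "is_weak_Xgrad X \<Omega> u v" and v': "is_weak_Xgrad X \<Omega> u' v'"
    and u: "integrable (lebesgue_on \<Omega>) u" and u': "integrable (lebesgue_on \<Omega>) u'"
  shows "is_weak_Xgrad X \<Omega> (\<lambda>x. u x + u' x) (\<lambda>x. v x + v' x)"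
  unfolding is_weak_Xgrad_def
proof (intro conjI allI impI ballI)
  show "(\<lambda>x. v x + v' x) \<in> borel_measurable (lebesgue_on \<Omega>)"
    using v v' unfolding is_weak_Xgrad_def by auto
  show "integrable (lebesgue_on K) (\<lambda>x. v x + v' x)" if "compact K \<and> K \<subseteq> \<Omega>" for K
    using v v' that unfolding is_weak_Xgrad_def by auto
  fix j \<psi> assume \<psi>: "\<psi> \<in> Cinfc \<Omega>"
  let ?g = "\<lambda>x. \<Sum>i\<in>UNIV. partial_deriv i (\<lambda>y. X j y $ i * \<psi> y) x"
  have "(LINT x|lebesgue_on \<Omega>. (v x + v' x) $ j * \<psi> x) =
      (LINT x|lebesgue_on \<Omega>. v x $ j * \<psi> x) + (LINT x|lebesgue_on \<Omega>. v' x $ j * \<psi> x)"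
    using integrable_mult_Cinfc[OF weak_Xgrad_integrable[OF v] \<psi>] integrable_mult_Cinfc[OF weak_Xgrad_integrable[OF v'] \<psi>]
    by (simp add: distrib_right)
  also have "\<dots> = - (LINT x|lebesgue_on \<Omega>. u x * ?g x) + - (LINT x|lebesgue_on \<Omega>. u' x * ?g x)"
    using v v' \<psi> unfolding is_weak_Xgrad_def by simp
  also have "\<dots> = - (LINT x|lebesgue_on \<Omega>. (u x + u' x) * ?g x)"
    using integrable_test[OF u \<psi>, of j] integrable_test[OF u' \<psi>, of j] by (simp add: distrib_right)
  finally show "(LINT x|lebesgue_on \<Omega>. (v x + v' x) $ j * \<psi> x) = - (LINT x|lebesgue_on \<Omega>. (u x + u' x) * ?g x)" .
qed

lemma is_weak_Xgrad_cmult: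
  assumes v: "is_weak_Xgrad X \<Omega> u v"
  shows "is_weak_Xgrad X \<Omega> (\<lambda>x. a * u x) (\<lambda>x. a *\<^sub>R v x)"
  using v unfolding is_weak_Xgrad_def by (auto simp: mult.assoc)

lemma Xgrad_W1pX:
  assumes "u \<in> W1pX X p \<Omega>"
  shows "is_weak_Xgrad X \<Omega> u (Xgrad X \<Omega> u)" and "Xgrad X \<Omega> u \<in> Lp p \<Omega>"
proof -
  obtain v where v: "v \<in> Lp p \<Omega>" "is_weak_Xgrad X \<Omega> u v"
    using assms unfolding W1pX_def by blast
  then show *: "is_weak_Xgrad X \<Omega> u (Xgrad X \<Omega> u)"
    unfolding Xgrad_def using someI[of "is_weak_Xgrad X \<Omega> u"] by blast
  have ae: "AE x in lebesgue_on \<Omega>. v x = Xgrad X \<Omega> u x"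
    using is_weak_Xgrad_unique[OF v(2) *] .
  have meas: "Xgrad X \<Omega> u \<in> borel_measurable (lebesgue_on \<Omega>)"
    using * unfolding is_weak_Xgrad_def by blast
  have "integrable (lebesgue_on \<Omega>) (\<lambda>x. norm (Xgrad X \<Omega> u x) powr p)"
  proof (rule integrable_cong_AE_imp)
    show "integrable (lebesgue_on \<Omega>) (\<lambda>x. norm (v x) powr p)" using v(1) unfolding Lp_def by blast
    show "(\<lambda>x. norm (Xgrad X \<Omega> u x) powr p) \<in> borel_measurable (lebesgue_on \<Omega>)" using meas by measurable
    show "AE x in lebesgue_on \<Omega>. norm (v x) powr p = norm (Xgrad X \<Omega> u x) powr p"
      using ae by eventually_elim simp
  qed
  then show "Xgrad X \<Omega> u \<in> Lp p \<Omega>" using meas unfolding Lp_def by blast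
qed

lemma Xgrad_add:
  assumes "u \<in> W1pX X p \<Omega>" "u' \<in> W1pX X p \<Omega>"
  shows "AE x in lebesgue_on \<Omega>. Xgrad X \<Omega> (\<lambda>x. u x + u' x) x = Xgrad X \<Omega> u x + Xgrad X \<Omega> u' x"
proof -
  have "integrable (lebesgue_on \<Omega>) u" "integrable (lebesgue_on \<Omega>) u'"
    using assms Lp_integrable by (auto simp: W1pX_def)
  then have *: "is_weak_Xgrad X \<Omega> (\<lambda>x. u x + u' x) (\<lambda>x. Xgrad X \<Omega> u x + Xgrad X \<Omega> u' x)"
    by (intro is_weak_Xgrad_add Xgrad_W1pX assms)
  then have "is_weak_Xgrad X \<Omega> (\<lambda>x. u x + u' x) (Xgrad X \<Omega> (\<lambda>x. u x + u' x))"
    unfolding Xgrad_def[of X \<Omega> "\<lambda>x. u x + u' x"]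
    by (rule someI[where P = "is_weak_Xgrad X \<Omega> (\<lambda>x. u x + u' x)"])
  then show ?thesis using is_weak_Xgrad_unique * by blast
qed

lemma Xgrad_cmult:
  assumes "u \<in> W1pX X p \<Omega>"
  shows "AE x in lebesgue_on \<Omega>. Xgrad X \<Omega> (\<lambda>x. a * u x) x = a *\<^sub>R Xgrad X \<Omega> u x"
proof -
  have *: "is_weak_Xgrad X \<Omega> (\<lambda>x. a * u x) (\<lambda>x. a *\<^sub>R Xgrad X \<Omega> u x)"
    by (intro is_weak_Xgrad_cmult Xgrad_W1pX assms)
  then have "is_weak_Xgrad X \<Omega> (\<lambda>x. a * u x) (Xgrad X \<Omega> (\<lambda>x. a * u x))"
    unfolding Xgrad_def[of X \<Omega> "\<lambda>x. a * u x"]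
    by (rule someI[where P = "is_weak_Xgrad X \<Omega> (\<lambda>x. a * u x)"])
  then show ?thesis using is_weak_Xgrad_unique * by blast
qed

end

section \<open>Convergence of convex functions\<close>

text \<open>
  Continue the segment from \<open>x\<close> to \<open>y\<close> by unit length beyond \<open>y\<close>, and use convexity on the
  longer segment.
\<close>

lemma convex_bounded_imp_Lipschitz:
  fixes f :: "'a::real_normed_vector \<Rightarrow> real"
  assumes f: "convex_on UNIV f" and B: "\<And>z. norm z \<le> R + 1 \<Longrightarrow> \<bar>f z\<bar> \<le> B"
    and x: "norm x \<le> R" and y: "norm y \<le> R"
  shows "\<bar>f x - f y\<bar> \<le> 2 * B * norm (x - y)"
proof -
  have *: "f y - f x \<le> 2 * B * norm (x - y)" if x: "norm x \<le> R" and y: "norm y \<le> R" for x y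
  proof (cases "x = y")
    case False
    define t where "t = norm (y - x)"
    have t: "t > 0" using False by (simp add: t_def)
    \<comment> \<open>The point at unit distance from \<open>y\<close> on the ray from \<open>x\<close> through \<open>y\<close>.\<close>
    define z where "z = y + (1 / t) *\<^sub>R (y - x)"
    have "norm z \<le> norm y + norm ((1 / t) *\<^sub>R (y - x))" unfolding z_def by (rule norm_triangle_ineq)
    also have "norm ((1 / t) *\<^sub>R (y - x)) = 1" using t by (simp add: t_def)
    finally have z: "norm z \<le> R + 1" using y by simp
    define l where "l = t / (1 + t)"
    have l: "0 \<le> l" "l \<le> 1" "l \<le> t" using t by (auto simp: l_def divide_simps)
    have "(1 + t) *\<^sub>R y = x + t *\<^sub>R z"
      using t by (simp add: z_def algebra_simps)
    then have "y = (1 / (1 + t)) *\<^sub>R (x + t *\<^sub>R z)"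
      using t by (simp flip: \<open>(1 + t) *\<^sub>R y = x + t *\<^sub>R z\<close>)
    also have "\<dots> = (1 - l) *\<^sub>R x + l *\<^sub>R z"
    proof -
      have "1 - l = 1 / (1 + t)" using t by (simp add: l_def field_simps)
      then show ?thesis by (simp add: scaleR_add_right l_def)
    qed
    finally have "f y \<le> (1 - l) * f x + l * f z"
      using convex_onD[OF f, of l x z] l by simp
    then have "f y - f x \<le> l * (f z - f x)"
      by (simp add: algebra_simps)
    also have "\<dots> \<le> l * (2 * B)"
      using B[OF z] B[of x] x l(1) by (intro mult_left_mono) auto
    also have "\<dots> \<le> t * (2 * B)"
      using l(3) B[of x] x by (intro mult_right_mono) auto
    finally show ?thesis
      by (simp add: t_def norm_minus_commute mult.commute)
  qed simp
  show ?thesis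
    using *[OF x y] *[OF y x] by (simp add: norm_minus_commute abs_le_iff)
qed

text \<open>
  The point \<open>(x, f x - \<delta>)\<close> lies outside the closed convex epigraph; a hyperplane that strictly
  separates the two is not vertical, and its translate through the point is the graph of the minorant.
\<close>

lemma convex_approx_subgradient:
  fixes f :: "'a::euclidean_space \<Rightarrow> real"
  assumes f: "convex_on UNIV f" and "0 < \<delta>"
  shows "\<exists>a. \<forall>y. f x + a \<bullet> (y - x) - \<delta> \<le> f y"
proof -
  have cont: "continuous_on UNIV f" using convex_on_continuous[OF open_UNIV f] .
  have "convex (epigraph UNIV f)"
    using f by (simp add: convex_epigraph)
  moreover have "closed (epigraph UNIV f)"
    unfolding epigraph_def
    by (auto intro!: closed_Collect_le continuous_intros continuous_on_compose2[OF cont])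
  moreover have "(x, f x - \<delta>) \<notin> epigraph UNIV f"
    using \<open>0 < \<delta>\<close> by (simp add: epigraph_def)
  ultimately obtain ab b where ab: "ab \<bullet> (x, f x - \<delta>) < b" "\<forall>z\<in>epigraph UNIV f. b < ab \<bullet> z"
    by (elim separating_hyperplane_closed_point[THEN exE] exE conjE)
  obtain a c where [simp]: "ab = (a, c)" by (cases ab)
  have sep: "a \<bullet> x + c * (f x - \<delta>) < a \<bullet> y + c * f y" for y
    using ab(1) bspec[OF ab(2), of "(y, f y)"] by (simp add: epigraph_def)
  have "0 < c * \<delta>" using sep[of x] by (simp add: algebra_simps)
  then have c: "0 < c" using \<open>0 < \<delta>\<close> by (simp add: zero_less_mult_iff)
  have "f x + (- (1 / c) *\<^sub>R a) \<bullet> (y - x) - \<delta> \<le> f y" for y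
  proof -
    have "c * (f x - \<delta>) - a \<bullet> (y - x) \<le> c * f y"
      using sep[of y] by (simp add: inner_diff_right)
    then have "(c * (f x - \<delta>) - a \<bullet> (y - x)) / c \<le> f y"
      using c by (simp add: divide_le_eq mult.commute)
    also have "(c * (f x - \<delta>) - a \<bullet> (y - x)) / c = f x + (- (1 / c) *\<^sub>R a) \<bullet> (y - x) - \<delta>"
      using c by (simp add: diff_divide_distrib)
    finally show ?thesis .
  qed
  then show ?thesis by blast
qed

lemma powr_superlinear:
  fixes c p A B :: real
  assumes "0 < c" "1 < p"
  shows "\<exists>R\<ge>1. \<forall>t\<ge>R. A + B * t \<le> c * t powr p"
proof -
  define K where "K = (\<bar>A\<bar> + \<bar>B\<bar>) / c"
  define R where "R = max 1 (K powr (1 / (p - 1)))"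
  have "A + B * t \<le> c * t powr p" if "R \<le> t" for t
  proof -
    have t: "1 \<le> t" "K powr (1 / (p - 1)) \<le> t" using that by (auto simp: R_def)
    have "K = (K powr (1 / (p - 1))) powr (p - 1)"
      using assms by (simp add: powr_powr K_def)
    also have "\<dots> \<le> t powr (p - 1)"
      using t assms by (intro powr_mono2) auto
    finally have "c * K \<le> c * t powr (p - 1)" using assms by simp
    then have "(\<bar>A\<bar> + \<bar>B\<bar>) * t \<le> c * t powr (p - 1) * t"
      using t assms by (intro mult_right_mono) (auto simp: K_def)
    also have "\<dots> = c * t powr p"
      using t powr_mult_base[of t "p - 1"] by (simp add: mult.commute mult.left_commute)
    finally have "(\<bar>A\<bar> + \<bar>B\<bar>) * t \<le> c * t powr p" .
    moreover have "A + B * t \<le> \<bar>A\<bar> * t + \<bar>B\<bar> * t"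
      using t mult_left_mono[of 1 t "\<bar>A\<bar>"] mult_right_mono[of B "\<bar>B\<bar>" t] by linarith
    ultimately show ?thesis by (simp add: distrib_right)
  qed
  then show ?thesis by (intro exI[of _ R]) (auto simp: R_def)
qed

text \<open>
  The situation at almost every point \<open>x\<close>: here \<open>\<phi> h\<close> is \<open>fh h x\<close>, \<open>\<psi>\<close> is \<open>f x\<close>, and the
  convergence is known only on a countable dense set, because for each argument it is
  given outside a null set that depends on this argument.
\<close>

locale convex_approximation =
  fixes \<phi> :: "nat \<Rightarrow> 'a::euclidean_space \<Rightarrow> real" and \<psi> :: "'a \<Rightarrow> real"
    and q :: "nat \<Rightarrow> 'a" and c0 c1 p A B :: real
  assumes c0: "0 < c0" and c1: "c0 \<le> c1" and p: "1 < p"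
    and convex_\<phi>: "\<And>h. convex_on UNIV (\<phi> h)" and convex_\<psi>: "convex_on UNIV \<psi>"
    and lower: "\<And>h \<eta>. c0 * norm \<eta> powr p - A \<le> \<phi> h \<eta>"
    and upper: "\<And>h \<eta>. \<phi> h \<eta> \<le> c1 * norm \<eta> powr p + B"
    and lim: "\<And>i. (\<lambda>h. \<phi> h (q i)) \<longlonglongrightarrow> \<psi> (q i)"
    and dense: "\<And>U. open U \<Longrightarrow> U \<noteq> {} \<Longrightarrow> \<exists>i. q i \<in> U"
begin

lemma dense_ball: "0 < r \<Longrightarrow> \<exists>i. norm (q i - x) < r"
  using dense[of "ball x r"] by (auto simp: dist_norm norm_minus_commute)

lemma equi_Lipschitz:
  assumes "0 \<le> R"
  obtains L where "0 < L" "\<And>h x y. norm x \<le> R \<Longrightarrow> norm y \<le> R \<Longrightarrow> \<bar>\<phi> h x - \<phi> h y\<bar> \<le> L * norm (x - y)"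
proof -
  define M where "M = c1 * (R + 1) powr p + \<bar>A\<bar> + \<bar>B\<bar>"
  have "0 < c1 * (R + 1) powr p" using assms c0 c1 by (intro mult_pos_pos) auto
  then have M: "0 < M" by (simp add: M_def)
  have bound: "\<bar>\<phi> h z\<bar> \<le> M" if "norm z \<le> R + 1" for h z
  proof -
    have "norm z powr p \<le> (R + 1) powr p" using that p by (intro powr_mono2) auto
    then have "c1 * norm z powr p \<le> c1 * (R + 1) powr p" using c0 c1 by simp
    moreover have "0 \<le> c1 * (R + 1) powr p" "0 \<le> c0 * norm z powr p" using c0 c1 by auto
    ultimately show ?thesis using lower[of z h] upper[of h z] unfolding M_def by linarith
  qed
  show thesis
    using convex_bounded_imp_Lipschitz[OF convex_\<phi> bound] M by (intro that[of "2 * M"]) auto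
qed

lemma LIMSEQ_everywhere: "(\<lambda>h. \<phi> h \<eta>) \<longlonglongrightarrow> \<psi> \<eta>"
proof (rule LIMSEQ_I)
  fix e :: real assume e: "0 < e"
  obtain L where L: "0 < L" "\<And>h x y. norm x \<le> norm \<eta> + 1 \<Longrightarrow> norm y \<le> norm \<eta> + 1 \<Longrightarrow> \<bar>\<phi> h x - \<phi> h y\<bar> \<le> L * norm (x - y)"
    using equi_Lipschitz[of "norm \<eta> + 1"] by auto
  have "isCont \<psi> \<eta>"
    using convex_on_continuous[OF open_UNIV convex_\<psi>] by (simp add: continuous_on_eq_continuous_at)
  then obtain d where d: "0 < d" "\<And>y. norm (y - \<eta>) < d \<Longrightarrow> \<bar>\<psi> y - \<psi> \<eta>\<bar> < e / 3"
    using e by (auto simp: continuous_at_eps_delta dist_norm dest!: spec[of _ "e / 3"])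
  obtain i where i: "norm (q i - \<eta>) < min (min 1 d) (e / (3 * L))"
    using dense_ball[of "min (min 1 d) (e / (3 * L))" \<eta>] e d L by auto
  have qi: "norm (q i) \<le> norm \<eta> + 1"
    using i norm_triangle_sub[of "q i" \<eta>] by simp
  obtain N where N: "\<And>h. h \<ge> N \<Longrightarrow> \<bar>\<phi> h (q i) - \<psi> (q i)\<bar> < e / 3"
    using LIMSEQ_D[OF lim[of i], of "e / 3"] e by auto
  have "\<bar>\<phi> h \<eta> - \<psi> \<eta>\<bar> < e" if "h \<ge> N" for h
  proof -
    have "\<bar>\<phi> h \<eta> - \<phi> h (q i)\<bar> \<le> L * norm (q i - \<eta>)"
      using L(2)[of \<eta> "q i" h] qi by (simp add: norm_minus_commute)
    also have "\<dots> < e / 3"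
      using i L(1) by (simp add: field_simps)
    finally have "\<bar>\<phi> h \<eta> - \<phi> h (q i)\<bar> < e / 3" .
    moreover have "\<bar>\<psi> (q i) - \<psi> \<eta>\<bar> < e / 3" using d(2) i by simp
    ultimately show ?thesis using N[OF that] by linarith
  qed
  then show "\<exists>no. \<forall>n\<ge>no. norm (\<phi> n \<eta> - \<psi> \<eta>) < e" by auto
qed

text \<open>
  Take a nearly exact affine minorant of \<open>\<psi>\<close> with slope \<open>a\<close>. Outside a ball of radius \<open>R\<close> every
  affine function with slope near \<open>a\<close> is below the common lower bound of the \<open>\<phi> h\<close>. On the
  ball a finite net and the common Lipschitz constant make the convergence uniform, and a small
  change of the slope costs little.
\<close>

lemma eventually_affine_minorant:
  assumes e: "0 < e"
  shows "\<exists>k N. \<forall>h\<ge>N. \<forall>\<eta>. \<psi> \<eta>0 + q k \<bullet> (\<eta> - \<eta>0) - e \<le> \<phi> h \<eta>"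
proof -
  obtain a where a: "\<And>y. \<psi> \<eta>0 + a \<bullet> (y - \<eta>0) - e / 4 \<le> \<psi> y"
    using convex_approx_subgradient[OF convex_\<psi>, of "e / 4" \<eta>0] e by auto
  obtain R where R: "1 \<le> R" "\<And>t. R \<le> t \<Longrightarrow> (A + \<psi> \<eta>0 + (norm a + 1) * norm \<eta>0) + (norm a + 1) * t \<le> c0 * t powr p"
    using powr_superlinear[OF c0 p] by blast
  \<comment> \<open>Replacing the slope \<open>a\<close> by \<open>q k\<close> costs at most \<open>d * P \<le> e / 4\<close> on the ball of radius \<open>R\<close>.\<close>
  define P where "P = R + norm \<eta>0"
  define d where "d = min 1 (e / (4 * P))"
  have d: "0 < d" "d \<le> 1" "d * (R + norm \<eta>0) \<le> e / 4"
  proof -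
    have pos: "0 < P" using R(1) norm_ge_zero[of \<eta>0] unfolding P_def by linarith
    show "0 < d" "d \<le> 1" using e pos by (auto simp: d_def)
    have "d * P \<le> e / (4 * P) * P"
      using pos by (intro mult_right_mono) (auto simp: d_def)
    also have "\<dots> = e / 4" using pos by simp
    finally show "d * (R + norm \<eta>0) \<le> e / 4" by (simp add: P_def)
  qed
  obtain k where k: "norm (q k - a) < d"
    using dense_ball[OF d(1)] by blast
  obtain L where L: "0 < L" "\<And>h x y. norm x \<le> R + 1 \<Longrightarrow> norm y \<le> R + 1 \<Longrightarrow> \<bar>\<phi> h x - \<phi> h y\<bar> \<le> L * norm (x - y)"
    using equi_Lipschitz[of "R + 1"] R(1) by auto
  \<comment> \<open>Moving from a point of the ball to the net costs at most \<open>L * r\<close> for \<open>\<phi> h\<close> and \<open>norm a * r\<close> for the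
    minorant.\<close>
  define M where "M = L + norm a"
  define r where "r = min 1 (e / (8 * M))"
  have M: "0 < M" using L(1) norm_ge_zero[of a] unfolding M_def by linarith
  have r: "0 < r" "r \<le> 1" "(L + norm a) * r \<le> e / 8"
  proof -
    show "0 < r" "r \<le> 1" using e M by (auto simp: r_def)
    have "M * r \<le> M * (e / (8 * M))"
      using M by (intro mult_left_mono) (auto simp: r_def)
    also have "\<dots> = e / 8" using M by simp
    finally show "(L + norm a) * r \<le> e / 8" by (simp add: M_def)
  qed
  have cover: "cball 0 R \<subseteq> (\<Union>i\<in>UNIV. ball (q i) r)"
    using dense_ball[OF r(1)] by (force simp: dist_norm)
  obtain I where I: "I \<subseteq> UNIV" "finite I" "cball 0 R \<subseteq> (\<Union>i\<in>I. ball (q i) r)"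
    by (rule compactE_image[OF compact_cball _ cover]) (rule open_ball)
  have "\<exists>N. \<forall>h\<ge>N. \<bar>\<phi> h (q i) - \<psi> (q i)\<bar> < e / 8" for i
    using LIMSEQ_D[OF lim[of i], of "e / 8"] e by auto
  then have "\<exists>N. \<forall>i. \<forall>h\<ge>N i. \<bar>\<phi> h (q i) - \<psi> (q i)\<bar> < e / 8"
    by (intro choice) blast
  then obtain N where N: "\<And>i h. h \<ge> N i \<Longrightarrow> \<bar>\<phi> h (q i) - \<psi> (q i)\<bar> < e / 8"
    by blast
  have "\<psi> \<eta>0 + q k \<bullet> (\<eta> - \<eta>0) - e \<le> \<phi> h \<eta>" if h: "h \<ge> Max (insert 0 (N ` I))" for h \<eta>
  proof (cases "norm \<eta> \<le> R")
    case True
    then obtain i where i: "i \<in> I" "norm (q i - \<eta>) < r"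
      using I(3) by (force simp: dist_norm)
    have "h \<ge> N i" using h i(1) I(2) Max_ge[of "insert 0 (N ` I)" "N i"] by auto
    have qi: "norm (q i) \<le> R + 1"
      using i(2) r(2) True norm_triangle_sub[of "q i" \<eta>] by linarith
    have "\<bar>\<phi> h \<eta> - \<phi> h (q i)\<bar> \<le> L * norm (\<eta> - q i)"
      using True qi by (intro L(2)) auto
    also have "\<dots> \<le> L * r" using i(2) L(1) by (simp add: norm_minus_commute)
    finally have 1: "\<phi> h (q i) - L * r \<le> \<phi> h \<eta>" by linarith
    have 2: "\<psi> (q i) - e / 8 \<le> \<phi> h (q i)" using N[OF \<open>h \<ge> N i\<close>] by linarith
    have 3: "\<psi> \<eta>0 + a \<bullet> (q i - \<eta>0) - e / 4 \<le> \<psi> (q i)" by (rule a)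
    have "\<bar>a \<bullet> (q i - \<eta>)\<bar> \<le> norm a * r"
      using Cauchy_Schwarz_ineq2[of a "q i - \<eta>"] i(2) mult_left_mono[of "norm (q i - \<eta>)" r "norm a"]
      by (auto intro: order_trans)
    moreover have "a \<bullet> (q i - \<eta>0) = a \<bullet> (\<eta> - \<eta>0) + a \<bullet> (q i - \<eta>)"
      by (simp add: inner_diff_right)
    ultimately have 4: "a \<bullet> (\<eta> - \<eta>0) - norm a * r \<le> a \<bullet> (q i - \<eta>0)" by linarith
    have "\<bar>(q k - a) \<bullet> (\<eta> - \<eta>0)\<bar> \<le> norm (q k - a) * norm (\<eta> - \<eta>0)"
      by (rule Cauchy_Schwarz_ineq2)
    also have "\<dots> \<le> d * (R + norm \<eta>0)"
      using k d(1) True norm_triangle_ineq4[of \<eta> \<eta>0] by (intro mult_mono) auto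
    finally have 5: "q k \<bullet> (\<eta> - \<eta>0) - e / 4 \<le> a \<bullet> (\<eta> - \<eta>0)"
      using d(3) by (simp add: inner_diff_left abs_le_iff)
    have "L * r + norm a * r \<le> e / 8" using r(3) by (simp add: distrib_right)
    then show ?thesis using 1 2 3 4 5 e by linarith
  next
    case False
    have "q k \<bullet> (\<eta> - \<eta>0) \<le> norm (q k) * norm (\<eta> - \<eta>0)"
      by (rule norm_cauchy_schwarz)
    also have "\<dots> \<le> (norm a + 1) * (norm \<eta> + norm \<eta>0)"
    proof (rule mult_mono)
      show "norm (q k) \<le> norm a + 1"
        using k d(2) norm_triangle_sub[of "q k" a] by linarith
    qed (auto intro: norm_triangle_ineq4)
    finally have "q k \<bullet> (\<eta> - \<eta>0) \<le> (norm a + 1) * norm \<eta> + (norm a + 1) * norm \<eta>0"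
      by (simp add: distrib_left)
    then show ?thesis
      using R(2)[of "norm \<eta>"] lower[of \<eta> h] e False by linarith
  qed
  then show ?thesis by blast
qed

end

section \<open>Gamma-convergence and weak neighbourhoods\<close>

text \<open>
  The limit inferior needs one neighbourhood for all large indices, up to \<open>\<epsilon>\<close>; constant sequences
  give the limit superior.
\<close>

lemma Gamma_convergesI:
  assumes liminf: "\<And>u \<epsilon>. u \<in> topspace Y \<Longrightarrow> 0 < \<epsilon> \<Longrightarrow>
      \<exists>U H. openin Y U \<and> u \<in> U \<and> (\<forall>h\<ge>H. \<forall>v\<in>U. F0 u - \<epsilon> \<le> F h v)"
    and lim: "\<And>u. u \<in> topspace Y \<Longrightarrow> (\<lambda>h. F h u) \<longlonglongrightarrow> F0 u"
  shows "Gamma_converges Y F F0"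
  unfolding Gamma_converges_def
proof (intro ballI)
  fix u assume u: "u \<in> topspace Y"
  let ?N = "{U. openin Y U \<and> u \<in> U}"
  let ?A = "SUP U\<in>?N. liminf (\<lambda>h. INF v\<in>U. ereal (F h v))"
  let ?B = "SUP U\<in>?N. limsup (\<lambda>h. INF v\<in>U. ereal (F h v))"
  have AB: "?A \<le> ?B"
    by (intro SUP_mono') (simp add: Liminf_le_Limsup)
  have BF: "?B \<le> ereal (F0 u)"
  proof (intro SUP_least)
    fix U assume "U \<in> ?N"
    then have "limsup (\<lambda>h. INF v\<in>U. ereal (F h v)) \<le> limsup (\<lambda>h. ereal (F h u))"
      by (intro Limsup_mono always_eventually allI INF_lower) auto
    also have "\<dots> = ereal (F0 u)"
      using lim[OF u] by (intro lim_imp_Limsup) auto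
    finally show "limsup (\<lambda>h. INF v\<in>U. ereal (F h v)) \<le> ereal (F0 u)" .
  qed
  have FA: "ereal (F0 u) \<le> ?A"
  proof (rule ereal_le_epsilon2)
    fix \<epsilon> :: real assume "0 < \<epsilon>"
    from liminf[OF u this] obtain U H where U: "openin Y U" "u \<in> U" "\<forall>h\<ge>H. \<forall>v\<in>U. F0 u - \<epsilon> \<le> F h v"
      by blast
    have "ereal (F0 u - \<epsilon>) \<le> liminf (\<lambda>h. INF v\<in>U. ereal (F h v))"
    proof (rule Liminf_bounded)
      show "\<forall>\<^sub>F h in sequentially. ereal (F0 u - \<epsilon>) \<le> (INF v\<in>U. ereal (F h v))"
        unfolding eventually_sequentially using U(3) by (intro exI[of _ H]) (auto intro!: INF_greatest)
    qed
    also have "\<dots> \<le> ?A"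
      using U by (intro SUP_upper) auto
    finally show "ereal (F0 u) \<le> ?A + ereal \<epsilon>"
      using add_right_mono[of "ereal (F0 u - \<epsilon>)" ?A "ereal \<epsilon>"] by simp
  qed
  show "ereal (F0 u) = ?A \<and> ereal (F0 u) = ?B"
    using FA order_trans[OF AB BF] order_trans[OF FA AB] BF by (intro conjI antisym)
qed

lemma topspace_weak_topology_of: "topspace (weak_topology_of V nrm) = V"
proof -
  have "(\<lambda>_. 0) \<in> dual_of V nrm"
    unfolding dual_of_def by (auto intro!: exI[of _ 0])
  then have "V \<in> {{u \<in> V. l u \<in> S} |l S. l \<in> dual_of V nrm \<and> open S}"
    by (intro CollectI exI[of _ "\<lambda>_. 0"] exI[of _ UNIV]) auto
  then show ?thesis
    unfolding weak_topology_of_def topology_generated_by_topspace by blast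
qed

lemma openin_weak_topology_of:
  assumes "l \<in> dual_of V nrm" "open S"
  shows "openin (weak_topology_of V nrm) {u \<in> V. l u \<in> S}"
  unfolding weak_topology_of_def using assms by (intro topology_generated_by_Basis) blast

lemma dense_sequence_exists:
  "\<exists>q :: nat \<Rightarrow> 'a::euclidean_space. \<forall>U. open U \<longrightarrow> U \<noteq> {} \<longrightarrow> (\<exists>i. q i \<in> U)"
proof -
  obtain D :: "'a set" where D: "countable D" "\<And>U. open U \<Longrightarrow> U \<noteq> {} \<Longrightarrow> \<exists>d\<in>D. d \<in> U"
    using countable_dense_setE by blast
  then have "D \<noteq> {}" by force
  then have "range (from_nat_into D) = D" using D(1) by simp
  then show ?thesis using D(2) by (intro exI[of _ "from_nat_into D"]) (metis rangeE)
qed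

context sobolev_setting
begin

text \<open>
  A substitute for Hoelder's inequality on sets of finite measure: integrate
  \<open>s \<le> t + t\<^sup>1\<^sup>-\<^sup>p s\<^sup>p\<close> with \<open>t\<close> the \<open>L\<^sup>p\<close> norm.
\<close>

lemma integral_norm_le_Lp_norm:
  fixes u :: "real^'n \<Rightarrow> 'b::euclidean_space"
  assumes u: "u \<in> Lp p \<Omega>"
  shows "(LINT x|lebesgue_on \<Omega>. norm (u x)) \<le> (measure (lebesgue_on \<Omega>) \<Omega> + 1) * Lp_norm p \<Omega> u"
proof -
  define I where "I = (LINT x|lebesgue_on \<Omega>. norm (u x) powr p)"
  have int: "integrable (lebesgue_on \<Omega>) (\<lambda>x. norm (u x) powr p)" using u unfolding Lp_def by blast
  have I: "0 \<le> I" unfolding I_def by (intro Bochner_Integration.integral_nonneg) simp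
  show ?thesis
  proof (cases "I = 0")
    case True
    then have "AE x in lebesgue_on \<Omega>. norm (u x) powr p = 0"
      using integral_nonneg_eq_0_iff_AE[OF int] unfolding I_def by simp
    then have "AE x in lebesgue_on \<Omega>. norm (u x) = 0"
      by eventually_elim (use p in simp)
    then have "(LINT x|lebesgue_on \<Omega>. norm (u x)) = 0"
      by (rule integral_eq_zero_AE)
    then show ?thesis by (simp add: Lp_norm_def)
  next
    case False
    then have "0 < I" using I by simp
    define t where "t = I powr (1 / p)"
    have t: "0 < t" using \<open>0 < I\<close> by (simp add: t_def)
    have tp: "t powr p = I" using \<open>0 < I\<close> p by (simp add: t_def powr_powr)
    have bound: "norm (u x) \<le> t + (t / I) * norm (u x) powr p" for x
    proof -
      have "norm (u x) / t \<le> 1 + (norm (u x) / t) powr p"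
        using t by (intro abs_le_1_plus_powr) simp
      also have "(norm (u x) / t) powr p = norm (u x) powr p / I"
        using t by (simp add: powr_divide tp)
      finally have "norm (u x) / t * t \<le> (1 + norm (u x) powr p / I) * t"
        using t by (intro mult_right_mono) auto
      then show ?thesis using t by (simp add: algebra_simps)
    qed
    have "(LINT x|lebesgue_on \<Omega>. norm (u x)) \<le> (LINT x|lebesgue_on \<Omega>. t + (t / I) * norm (u x) powr p)"
      using int Lp_integrable[OF u] bound by (intro integral_mono) auto
    also have "\<dots> = t * measure (lebesgue_on \<Omega>) \<Omega> + (t / I) * I"
      using int by (simp add: I_def)
    also have "\<dots> = (measure (lebesgue_on \<Omega>) \<Omega> + 1) * t"
      using \<open>0 < I\<close> by (simp add: algebra_simps)
    finally show ?thesis by (simp add: Lp_norm_def t_def I_def)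
  qed
qed

lemma integrable_bounded_inner:
  fixes \<xi> w :: "real^'n \<Rightarrow> 'b::euclidean_space"
  assumes \<xi>: "\<xi> \<in> borel_measurable (lebesgue_on \<Omega>)" "\<And>x. norm (\<xi> x) \<le> K"
    and w: "integrable (lebesgue_on \<Omega>) w"
  shows "integrable (lebesgue_on \<Omega>) (\<lambda>x. \<xi> x \<bullet> w x)"
    and "\<bar>LINT x|lebesgue_on \<Omega>. \<xi> x \<bullet> w x\<bar> \<le> K * (LINT x|lebesgue_on \<Omega>. norm (w x))"
proof -
  have b: "\<bar>\<xi> x \<bullet> w x\<bar> \<le> K * norm (w x)" for x
    using Cauchy_Schwarz_ineq2[of "\<xi> x" "w x"] mult_right_mono[OF \<xi>(2)[of x], of "norm (w x)"] by auto
  show int: "integrable (lebesgue_on \<Omega>) (\<lambda>x. \<xi> x \<bullet> w x)"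
  proof (rule Bochner_Integration.integrable_bound)
    show "integrable (lebesgue_on \<Omega>) (\<lambda>x. K * norm (w x))" using w by simp
    show "(\<lambda>x. \<xi> x \<bullet> w x) \<in> borel_measurable (lebesgue_on \<Omega>)"
      using \<xi>(1) borel_measurable_integrable[OF w] by (rule borel_measurable_inner)
    show "AE x in lebesgue_on \<Omega>. norm (\<xi> x \<bullet> w x) \<le> norm (K * norm (w x))"
      using b by (intro AE_I2) (metis abs_ge_self order_trans real_norm_def)
  qed
  have "\<bar>LINT x|lebesgue_on \<Omega>. \<xi> x \<bullet> w x\<bar> \<le> (LINT x|lebesgue_on \<Omega>. \<bar>\<xi> x \<bullet> w x\<bar>)"
    by (rule integral_abs_bound)
  also have "\<dots> \<le> (LINT x|lebesgue_on \<Omega>. K * norm (w x))"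
    using int w b by (intro integral_mono) auto
  finally show "\<bar>LINT x|lebesgue_on \<Omega>. \<xi> x \<bullet> w x\<bar> \<le> K * (LINT x|lebesgue_on \<Omega>. norm (w x))" by simp
qed

lemma Lp_norm_le_W1pX_norm:
  "Lp_norm p \<Omega> u \<le> W1pX_norm X p \<Omega> u" "Lp_norm p \<Omega> (Xgrad X \<Omega> u) \<le> W1pX_norm X p \<Omega> u"
proof -
  have nn: "0 \<le> (LINT x|lebesgue_on \<Omega>. \<bar>u x\<bar> powr p)" "0 \<le> (LINT x|lebesgue_on \<Omega>. norm (Xgrad X \<Omega> u x) powr p)"
    by (auto intro!: Bochner_Integration.integral_nonneg)
  show "Lp_norm p \<Omega> u \<le> W1pX_norm X p \<Omega> u" "Lp_norm p \<Omega> (Xgrad X \<Omega> u) \<le> W1pX_norm X p \<Omega> u"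
    unfolding Lp_norm_def W1pX_norm_def real_norm_def using nn p by (auto intro!: powr_mono2)
qed

lemma gradient_functional_in_dual:
  fixes \<xi> :: "real^'n \<Rightarrow> real^'m"
  assumes \<xi>: "\<xi> \<in> borel_measurable (lebesgue_on \<Omega>)" "\<And>x. norm (\<xi> x) \<le> K" and V: "V \<subseteq> W1pX X p \<Omega>"
  shows "(\<lambda>u. LINT x|lebesgue_on \<Omega>. \<xi> x \<bullet> Xgrad X \<Omega> u x) \<in> dual_of V (W1pX_norm X p \<Omega>)"
  unfolding dual_of_def
proof (intro CollectI conjI ballI allI exI)
  have int: "integrable (lebesgue_on \<Omega>) (Xgrad X \<Omega> u)" if "u \<in> V" for u
    using Lp_integrable Xgrad_W1pX(2) V that by blast
  note int' = integrable_bounded_inner[OF \<xi> int]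
  have meas: "Xgrad X \<Omega> u \<in> borel_measurable (lebesgue_on \<Omega>)" if "is_weak_Xgrad X \<Omega> u v" for u v
    unfolding Xgrad_def using someI[of "is_weak_Xgrad X \<Omega> u", OF that] unfolding is_weak_Xgrad_def by blast
  have L1: "integrable (lebesgue_on \<Omega>) u" if "u \<in> V" for u
    using V that Lp_integrable by (auto simp: W1pX_def)
  fix u assume u: "u \<in> V"
  show "(LINT x|lebesgue_on \<Omega>. \<xi> x \<bullet> Xgrad X \<Omega> (\<lambda>x. u x + v x) x) =
      (LINT x|lebesgue_on \<Omega>. \<xi> x \<bullet> Xgrad X \<Omega> u x) + (LINT x|lebesgue_on \<Omega>. \<xi> x \<bullet> Xgrad X \<Omega> v x)"
    if v: "v \<in> V" for v
  proof -
    have mX: "Xgrad X \<Omega> (\<lambda>x. u x + v x) \<in> borel_measurable (lebesgue_on \<Omega>)"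
      by (rule meas[OF is_weak_Xgrad_add[OF Xgrad_W1pX(1) Xgrad_W1pX(1)]]) (use u v V L1 in auto)
    have "(LINT x|lebesgue_on \<Omega>. \<xi> x \<bullet> Xgrad X \<Omega> (\<lambda>x. u x + v x) x) =
        (LINT x|lebesgue_on \<Omega>. \<xi> x \<bullet> Xgrad X \<Omega> u x + \<xi> x \<bullet> Xgrad X \<Omega> v x)"
    proof (rule integral_cong_AE)
      show "AE x in lebesgue_on \<Omega>. \<xi> x \<bullet> Xgrad X \<Omega> (\<lambda>x. u x + v x) x =
          \<xi> x \<bullet> Xgrad X \<Omega> u x + \<xi> x \<bullet> Xgrad X \<Omega> v x"
        using Xgrad_add[OF subsetD[OF V u] subsetD[OF V v]]
        by eventually_elim (simp add: inner_add_right)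
      show "(\<lambda>x. \<xi> x \<bullet> Xgrad X \<Omega> u x + \<xi> x \<bullet> Xgrad X \<Omega> v x) \<in> borel_measurable (lebesgue_on \<Omega>)"
        using borel_measurable_integrable[OF int'(1)] u v by (intro borel_measurable_add)
    qed (rule borel_measurable_inner[OF \<xi>(1) mX])
    then show ?thesis using int'(1)[OF u] int'(1)[OF v] by simp
  qed
  show "(LINT x|lebesgue_on \<Omega>. \<xi> x \<bullet> Xgrad X \<Omega> (\<lambda>x. a * u x) x) = a * (LINT x|lebesgue_on \<Omega>. \<xi> x \<bullet> Xgrad X \<Omega> u x)" for a
  proof -
    have mX: "Xgrad X \<Omega> (\<lambda>x. a * u x) \<in> borel_measurable (lebesgue_on \<Omega>)"
      by (rule meas[OF is_weak_Xgrad_cmult[OF Xgrad_W1pX(1)]]) (use u V in auto)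
    have "(LINT x|lebesgue_on \<Omega>. \<xi> x \<bullet> Xgrad X \<Omega> (\<lambda>x. a * u x) x) =
        (LINT x|lebesgue_on \<Omega>. a * (\<xi> x \<bullet> Xgrad X \<Omega> u x))"
    proof (rule integral_cong_AE)
      show "AE x in lebesgue_on \<Omega>. \<xi> x \<bullet> Xgrad X \<Omega> (\<lambda>x. a * u x) x = a * (\<xi> x \<bullet> Xgrad X \<Omega> u x)"
        using Xgrad_cmult[OF subsetD[OF V u], of a] by eventually_elim simp
      show "(\<lambda>x. a * (\<xi> x \<bullet> Xgrad X \<Omega> u x)) \<in> borel_measurable (lebesgue_on \<Omega>)"
        using borel_measurable_integrable[OF int'(1)[OF u]] by (intro borel_measurable_times borel_measurable_const)
    qed (rule borel_measurable_inner[OF \<xi>(1) mX])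
    then show ?thesis by simp
  qed
  have K: "0 \<le> K" using \<xi>(2) norm_ge_zero order_trans by blast
  have "\<bar>LINT x|lebesgue_on \<Omega>. \<xi> x \<bullet> Xgrad X \<Omega> u x\<bar> \<le> K * (LINT x|lebesgue_on \<Omega>. norm (Xgrad X \<Omega> u x))"
    by (rule int'(2)[OF u])
  also have "\<dots> \<le> K * ((measure (lebesgue_on \<Omega>) \<Omega> + 1) * W1pX_norm X p \<Omega> u)"
    using K u V Xgrad_W1pX(2) Lp_norm_le_W1pX_norm(2)
    by (intro mult_left_mono order_trans[OF integral_norm_le_Lp_norm]) (auto intro!: add_nonneg_nonneg)
  finally show "\<bar>LINT x|lebesgue_on \<Omega>. \<xi> x \<bullet> Xgrad X \<Omega> u x\<bar> \<le> K * (measure (lebesgue_on \<Omega>) \<Omega> + 1) * W1pX_norm X p \<Omega> u"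
    by (simp add: mult.assoc)
qed

lemma function_functional_in_dual:
  fixes \<xi> :: "real^'n \<Rightarrow> real"
  assumes \<xi>: "\<xi> \<in> borel_measurable (lebesgue_on \<Omega>)" "\<And>x. norm (\<xi> x) \<le> K" and V: "V \<subseteq> W1pX X p \<Omega>"
  shows "(\<lambda>u. LINT x|lebesgue_on \<Omega>. \<xi> x \<bullet> u x) \<in> dual_of V (W1pX_norm X p \<Omega>)"
  unfolding dual_of_def
proof (intro CollectI conjI ballI allI exI)
  have Lp: "u \<in> Lp p \<Omega>" if "u \<in> V" for u using V that by (auto simp: W1pX_def)
  note int' = integrable_bounded_inner[OF \<xi> Lp_integrable[OF Lp]]
  fix u assume u: "u \<in> V"
  show "(LINT x|lebesgue_on \<Omega>. \<xi> x \<bullet> (u x + v x)) = (LINT x|lebesgue_on \<Omega>. \<xi> x \<bullet> u x) + (LINT x|lebesgue_on \<Omega>. \<xi> x \<bullet> v x)"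
    if v: "v \<in> V" for v
    using int'(1)[OF u] int'(1)[OF v] by (simp add: inner_add_right del: inner_real_def)
  show "(LINT x|lebesgue_on \<Omega>. \<xi> x \<bullet> (a * u x)) = a * (LINT x|lebesgue_on \<Omega>. \<xi> x \<bullet> u x)" for a
    by (simp add: mult.left_commute)
  have K: "0 \<le> K" using \<xi>(2) norm_ge_zero order_trans by blast
  have "\<bar>LINT x|lebesgue_on \<Omega>. \<xi> x \<bullet> u x\<bar> \<le> K * (LINT x|lebesgue_on \<Omega>. norm (u x))"
    by (rule int'(2)[OF u])
  also have "\<dots> \<le> K * ((measure (lebesgue_on \<Omega>) \<Omega> + 1) * W1pX_norm X p \<Omega> u)"
    using K u Lp Lp_norm_le_W1pX_norm(1)
    by (intro mult_left_mono order_trans[OF integral_norm_le_Lp_norm]) (auto intro!: add_nonneg_nonneg)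
  finally show "\<bar>LINT x|lebesgue_on \<Omega>. \<xi> x \<bullet> u x\<bar> \<le> K * (measure (lebesgue_on \<Omega>) \<Omega> + 1) * W1pX_norm X p \<Omega> u"
    by (simp add: mult.assoc)
qed

end

section \<open>Integral functionals of the gradient\<close>

context sobolev_setting
begin

lemma integrand_measurable:
  fixes w :: "real^'n \<Rightarrow> real^'m"
  assumes f: "f \<in> integrand_class p \<Omega> c0 c1 a0 a1" and w: "w \<in> borel_measurable (lebesgue_on \<Omega>)"
  shows "(\<lambda>x. f x (w x)) \<in> borel_measurable (lebesgue_on \<Omega>)"
proof -
  have "(\<lambda>x. x) \<in> borel_measurable (lebesgue_on \<Omega>)"
    by (intro measurable_restrict_space1 measurable_completion) simp
  then have "(\<lambda>x. (x, w x)) \<in> measurable (lebesgue_on \<Omega>) (restrict_space borel (\<Omega> \<times> UNIV))"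
    using w by (intro measurable_restrict_space2 borel_measurable_Pair) auto
  moreover have "(\<lambda>(x, \<eta>). f x \<eta>) \<in> borel_measurable (restrict_space borel (\<Omega> \<times> UNIV))"
    using f unfolding integrand_class_def by blast
  ultimately show ?thesis
    by (auto dest: measurable_compose)
qed

lemma integrand_integrable:
  fixes w :: "real^'n \<Rightarrow> real^'m"
  assumes f: "f \<in> integrand_class p \<Omega> c0 c1 a0 a1" and "0 \<le> c0" "0 \<le> c1"
    and a: "integrable (lebesgue_on \<Omega>) a0" "integrable (lebesgue_on \<Omega>) a1" and w: "w \<in> Lp p \<Omega>"
  shows "integrable (lebesgue_on \<Omega>) (\<lambda>x. f x (w x))"
    and "AE x in lebesgue_on \<Omega>. \<bar>f x (w x)\<bar> \<le> c1 * norm (w x) powr p + \<bar>a0 x\<bar> + \<bar>a1 x\<bar>"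
proof -
  have "AE x in lebesgue_on \<Omega>. \<forall>\<eta>. c0 * norm \<eta> powr p - a0 x \<le> f x \<eta> \<and> f x \<eta> \<le> c1 * norm \<eta> powr p + a1 x"
    using f unfolding integrand_class_def by blast
  then show ae: "AE x in lebesgue_on \<Omega>. \<bar>f x (w x)\<bar> \<le> c1 * norm (w x) powr p + \<bar>a0 x\<bar> + \<bar>a1 x\<bar>"
  proof eventually_elim
    case (elim x)
    have "0 \<le> c0 * norm (w x) powr p" "0 \<le> c1 * norm (w x) powr p"
      using assms by auto
    with spec[OF elim, of "w x"] show ?case by linarith
  qed
  show "integrable (lebesgue_on \<Omega>) (\<lambda>x. f x (w x))"
  proof (rule Bochner_Integration.integrable_bound)
    show "integrable (lebesgue_on \<Omega>) (\<lambda>x. c1 * norm (w x) powr p + \<bar>a0 x\<bar> + \<bar>a1 x\<bar>)"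
      using w a unfolding Lp_def by auto
    show "(\<lambda>x. f x (w x)) \<in> borel_measurable (lebesgue_on \<Omega>)"
      using w unfolding Lp_def by (intro integrand_measurable[OF f]) auto
    show "AE x in lebesgue_on \<Omega>. norm (f x (w x)) \<le> norm (c1 * norm (w x) powr p + \<bar>a0 x\<bar> + \<bar>a1 x\<bar>)"
      using ae by eventually_elim auto
  qed
qed

end

locale converging_integrands = sobolev_setting \<Omega> \<Omega>0 X p
  for \<Omega> \<Omega>0 :: "(real^'n::finite) set" and X :: "'m::finite \<Rightarrow> real^'n \<Rightarrow> real^'n" and p :: real +
  fixes c0 c1 :: real and a0 a1 :: "real^'n \<Rightarrow> real"
    and fh :: "nat \<Rightarrow> real^'n \<Rightarrow> real^'m \<Rightarrow> real" and f :: "real^'n \<Rightarrow> real^'m \<Rightarrow> real"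
  assumes c0: "0 < c0" and c1: "c0 \<le> c1"
    and a0: "integrable (lebesgue_on \<Omega>) a0" and a1: "integrable (lebesgue_on \<Omega>) a1"
    and fh: "\<And>h. fh h \<in> integrand_class p \<Omega> c0 c1 a0 a1" and f: "f \<in> integrand_class p \<Omega> c0 c1 a0 a1"
    and lim: "\<And>\<eta>. AE x in lebesgue_on \<Omega>. (\<lambda>h. fh h x \<eta>) \<longlonglongrightarrow> f x \<eta>"
begin

lemma integrable_fh: "w \<in> Lp p \<Omega> \<Longrightarrow> integrable (lebesgue_on \<Omega>) (\<lambda>x. fh h x (w x))"
  using integrand_integrable(1)[OF fh _ _ a0 a1] c0 c1 by simp

lemma integrable_f: "w \<in> Lp p \<Omega> \<Longrightarrow> integrable (lebesgue_on \<Omega>) (\<lambda>x. f x (w x))"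
  using integrand_integrable(1)[OF f _ _ a0 a1] c0 c1 by simp

lemma AE_convex_approximation:
  assumes q: "\<forall>U. open U \<longrightarrow> U \<noteq> {} \<longrightarrow> (\<exists>i. q i \<in> U)"
  shows "AE x in lebesgue_on \<Omega>. convex_approximation (\<lambda>h. fh h x) (f x) q c0 c1 p (a0 x) (a1 x)"
proof -
  have 1: "AE x in lebesgue_on \<Omega>. \<forall>h. convex_on UNIV (fh h x)"
    using fh unfolding integrand_class_def by (subst AE_all_countable) blast
  have 2: "AE x in lebesgue_on \<Omega>. \<forall>h. \<forall>\<eta>. c0 * norm \<eta> powr p - a0 x \<le> fh h x \<eta> \<and> fh h x \<eta> \<le> c1 * norm \<eta> powr p + a1 x"
    using fh unfolding integrand_class_def by (subst AE_all_countable) blast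
  have 3: "AE x in lebesgue_on \<Omega>. \<forall>i. (\<lambda>h. fh h x (q i)) \<longlonglongrightarrow> f x (q i)"
    using lim by (subst AE_all_countable) blast
  have 4: "AE x in lebesgue_on \<Omega>. convex_on UNIV (f x)"
    using f unfolding integrand_class_def by blast
  from 1 2 3 4 show ?thesis
    by eventually_elim (unfold_locales; use c0 c1 p q in blast)
qed

lemma integral_fh_tendsto:
  assumes w: "w \<in> Lp p \<Omega>"
  shows "(\<lambda>h. LINT x|lebesgue_on \<Omega>. fh h x (w x)) \<longlonglongrightarrow> (LINT x|lebesgue_on \<Omega>. f x (w x))"
proof (rule integral_dominated_convergence[where w = "\<lambda>x. c1 * norm (w x) powr p + \<bar>a0 x\<bar> + \<bar>a1 x\<bar>"])
  obtain q :: "nat \<Rightarrow> real^'m" where q: "\<forall>U. open U \<longrightarrow> U \<noteq> {} \<longrightarrow> (\<exists>i. q i \<in> U)"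
    using dense_sequence_exists ..
  show "AE x in lebesgue_on \<Omega>. (\<lambda>h. fh h x (w x)) \<longlonglongrightarrow> f x (w x)"
    using AE_convex_approximation[OF q] by eventually_elim (rule convex_approximation.LIMSEQ_everywhere)
  show "AE x in lebesgue_on \<Omega>. norm (fh h x (w x)) \<le> c1 * norm (w x) powr p + \<bar>a0 x\<bar> + \<bar>a1 x\<bar>" for h
    using integrand_integrable(2)[OF fh _ _ a0 a1 w] c0 c1 by simp
  show "integrable (lebesgue_on \<Omega>) (\<lambda>x. c1 * norm (w x) powr p + \<bar>a0 x\<bar> + \<bar>a1 x\<bar>)"
    using w a0 a1 unfolding Lp_def by auto
qed (use integrable_fh[OF w] integrable_f[OF w] in auto)

text \<open>
  For large \<open>n\<close> the points \<open>x\<close> at which some slope of index at most \<open>n\<close> and the threshold \<open>n\<close> are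
  admissible in \<open>eventually_affine_minorant\<close> fill \<open>\<Omega>\<close> up to a small set. There \<open>\<xi>\<close> is the
  first admissible slope, so that it has finitely many values. On the small set \<open>\<xi>\<close> is zero,
  and the bound \<open>- a0 \<le> fh h\<close> is used, at the cost of a small integral of \<open>\<bar>f x (w x)\<bar> + \<bar>a0 x\<bar>\<close>.
\<close>

lemma uniform_affine_minorant:
  assumes w: "w \<in> Lp p \<Omega>" and e: "0 < e"
  shows "\<exists>\<xi> K N. \<xi> \<in> borel_measurable (lebesgue_on \<Omega>) \<and> (\<forall>x. norm (\<xi> x) \<le> K) \<and>
    (\<forall>h\<ge>N. \<forall>v\<in>Lp p \<Omega>. (LINT x|lebesgue_on \<Omega>. f x (w x)) + (LINT x|lebesgue_on \<Omega>. \<xi> x \<bullet> v x)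
        - (LINT x|lebesgue_on \<Omega>. \<xi> x \<bullet> w x) - e \<le> (LINT x|lebesgue_on \<Omega>. fh h x (v x)))"
proof -
  let ?M = "lebesgue_on \<Omega>"
  define \<mu> where "\<mu> = measure ?M \<Omega>"
  \<comment> \<open>The summand \<open>1\<close> avoids a division by zero when \<open>\<Omega>\<close> is empty.\<close>
  define d where "d = e / (2 * (\<mu> + 1))"
  have \<mu>: "0 \<le> \<mu>" by (simp add: \<mu>_def)
  have d: "0 < d" "d * \<mu> \<le> e / 2"
  proof -
    show "0 < d" using e \<mu> by (simp add: d_def)
    have "d * \<mu> \<le> d * (\<mu> + 1)" using \<open>0 < d\<close> by simp
    also have "\<dots> = e / 2" using \<mu> by (simp add: d_def field_simps)
    finally show "d * \<mu> \<le> e / 2" .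
  qed
  obtain q :: "nat \<Rightarrow> real^'m" where q: "\<forall>U. open U \<longrightarrow> U \<noteq> {} \<longrightarrow> (\<exists>i. q i \<in> U)"
    using dense_sequence_exists ..
  note approx = AE_convex_approximation[OF q]
  have wm[measurable]: "w \<in> borel_measurable ?M" using w unfolding Lp_def by blast
  have [measurable]: "(\<lambda>x. fh h x (q i)) \<in> borel_measurable ?M" for h i
    by (rule integrand_measurable[OF fh]) simp
  have [measurable]: "(\<lambda>x. f x (w x)) \<in> borel_measurable ?M"
    by (rule integrand_measurable[OF f wm])
  \<comment> \<open>The slope \<open>q k\<close> and the threshold \<open>n\<close> are admissible at \<open>x\<close>. Testing the inequality on the dense
    sequence keeps this condition measurable; continuity extends it to all arguments below.\<close>
  define G where "G k n x \<longleftrightarrow> (\<forall>h\<ge>n. \<forall>i. f x (w x) + q k \<bullet> (q i - w x) - d \<le> fh h x (q i))" for k n x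
  define S where "S n x \<longleftrightarrow> (\<exists>k\<le>n. G k n x)" for n x
  have G_meas[measurable]: "Measurable.pred ?M (G k n)" for k n
    unfolding G_def by measurable
  have S_meas[measurable]: "Measurable.pred ?M (S n)" for n
    unfolding S_def by measurable
  have ev: "AE x in ?M. eventually (\<lambda>n. S n x) sequentially"
    using approx
  proof eventually_elim
    case (elim x)
    then interpret convex_approximation "\<lambda>h. fh h x" "f x" q c0 c1 p "a0 x" "a1 x" .
    obtain k N where kN: "\<forall>h\<ge>N. \<forall>\<eta>. f x (w x) + q k \<bullet> (\<eta> - w x) - d \<le> fh h x \<eta>"
      using eventually_affine_minorant[OF d(1), of "w x"] by blast
    have "S n x" if "n \<ge> max k N" for n
      unfolding S_def G_def using kN that by (intro exI[of _ k]) auto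
    then show ?case unfolding eventually_sequentially by blast
  qed
  define b where "b x = \<bar>f x (w x)\<bar> + \<bar>a0 x\<bar>" for x
  have b: "integrable ?M b" unfolding b_def using integrable_f[OF w] a0 by auto
  \<comment> \<open>The error of the minorant off the set where \<open>S n\<close> holds; \<open>b\<close> dominates it.\<close>
  define r where "r n x = (if S n x then 0 else b x)" for n x
  have r: "integrable ?M (r n)" for n
  proof (rule Bochner_Integration.integrable_bound[OF b])
    show "r n \<in> borel_measurable ?M" unfolding r_def using borel_measurable_integrable[OF b] by measurable
  qed (auto simp: r_def)
  have "(\<lambda>n. LINT x|?M. r n x) \<longlonglongrightarrow> (LINT x|?M. 0)"
  proof (rule integral_dominated_convergence[OF _ _ b])
    show "AE x in ?M. (\<lambda>n. r n x) \<longlonglongrightarrow> 0"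
      using ev
    proof eventually_elim
      case (elim x)
      then have "eventually (\<lambda>n. r n x = 0) sequentially" by eventually_elim (simp add: r_def)
      then show ?case by (rule tendsto_eventually)
    qed
    show "AE x in ?M. norm (r n x) \<le> b x" for n
      by (intro AE_I2) (simp add: r_def b_def)
  qed (use r in auto)
  then have "eventually (\<lambda>n. (LINT x|?M. r n x) < e / 2) sequentially"
    using e by (intro order_tendstoD(2)[where y = 0]) auto
  then obtain n where n: "(LINT x|?M. r n x) < e / 2"
    unfolding eventually_sequentially by blast
  define \<xi> where "\<xi> x = (if S n x then q (LEAST k. G k n x) else 0)" for x
  have "(\<lambda>x. LEAST k. G k n x) \<in> measurable ?M (count_space UNIV)"
    by measurable
  then have "(\<lambda>x. q (LEAST k. G k n x)) \<in> borel_measurable ?M"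
    by (rule measurable_compose) simp
  then have \<xi>_meas: "\<xi> \<in> borel_measurable ?M"
    unfolding \<xi>_def by measurable
  have least: "(LEAST k. G k n x) \<le> n" "G (LEAST k. G k n x) n x" if "S n x" for x
  proof -
    from that obtain k where "k \<le> n" "G k n x" unfolding S_def by blast
    then show "(LEAST k. G k n x) \<le> n" "G (LEAST k. G k n x) n x"
      by (auto intro: LeastI Least_le order_trans)
  qed
  define K where "K = (\<Sum>k\<le>n. norm (q k))"
  have \<xi>_bound: "norm (\<xi> x) \<le> K" for x
    unfolding \<xi>_def K_def using least(1)[of x]
    by (auto intro!: member_le_sum[of _ "{..n}" "\<lambda>k. norm (q k)"] sum_nonneg)
  have "(LINT x|?M. f x (w x)) + (LINT x|?M. \<xi> x \<bullet> v x) - (LINT x|?M. \<xi> x \<bullet> w x) - e \<le> (LINT x|?M. fh h x (v x))"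
    if h: "n \<le> h" and v: "v \<in> Lp p \<Omega>" for h v
  proof -
    note int = integrable_f[OF w] integrable_fh[OF v, of h] r
      integrable_bounded_inner(1)[OF \<xi>_meas \<xi>_bound Lp_integrable[OF v]]
      integrable_bounded_inner(1)[OF \<xi>_meas \<xi>_bound Lp_integrable[OF w]]
    have "(LINT x|?M. f x (w x) + \<xi> x \<bullet> v x - \<xi> x \<bullet> w x - d - r n x) \<le> (LINT x|?M. fh h x (v x))"
    proof (rule integral_mono_AE)
      show "AE x in ?M. f x (w x) + \<xi> x \<bullet> v x - \<xi> x \<bullet> w x - d - r n x \<le> fh h x (v x)"
        using approx
      proof eventually_elim
        case (elim x)
        then interpret convex_approximation "\<lambda>h. fh h x" "f x" q c0 c1 p "a0 x" "a1 x" .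
        show ?case
        proof (cases "S n x")
          case True
          let ?k = "LEAST k. G k n x"
          have G: "\<forall>i. f x (w x) + q ?k \<bullet> (q i - w x) - d \<le> fh h x (q i)"
            using least(2)[OF True] h unfolding G_def by blast
          define B where "B = {\<eta>. fh h x \<eta> < f x (w x) + q ?k \<bullet> (\<eta> - w x) - d}"
          have "continuous_on UNIV (fh h x)"
            using convex_on_continuous[OF open_UNIV convex_\<phi>] .
          then have "open B"
            unfolding B_def by (intro open_Collect_less continuous_intros) auto
          have "B = {}"
          proof (rule ccontr)
            assume "B \<noteq> {}"
            then obtain i where "q i \<in> B" using dense[OF \<open>open B\<close>] by blast
            with G show False unfolding B_def using leD by blast
          qed
          then have "f x (w x) + q ?k \<bullet> (v x - w x) - d \<le> fh h x (v x)"
            unfolding B_def by (auto simp: not_less)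
          then show ?thesis using True by (simp add: \<xi>_def r_def inner_diff_right)
        next
          case False
          have "0 \<le> c0 * norm (v x) powr p" using c0 by simp
          then have "- a0 x \<le> fh h x (v x)" using lower[of "v x" h] by linarith
          then show ?thesis using False d(1) by (simp add: \<xi>_def r_def b_def)
        qed
      qed
    qed (use int in auto)
    moreover have "(LINT x|?M. f x (w x) + \<xi> x \<bullet> v x - \<xi> x \<bullet> w x - d - r n x) =
        (LINT x|?M. f x (w x)) + (LINT x|?M. \<xi> x \<bullet> v x) - (LINT x|?M. \<xi> x \<bullet> w x) - d * \<mu> - (LINT x|?M. r n x)"
      using int by (simp add: \<mu>_def)
    ultimately show ?thesis using n d(2) by linarith
  qed
  then show ?thesis using \<xi>_meas \<xi>_bound by blast
qed

text \<open>
  The neighbourhood is a half-space of the weak topology, given by the functional of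
  \<open>uniform_affine_minorant\<close>.
\<close>

lemma energy_lower_semicontinuous:
  assumes V: "V \<subseteq> W1pX X p \<Omega>" and u: "u \<in> V" and e: "0 < e"
  shows "\<exists>U H. openin (weak_topology_of V (W1pX_norm X p \<Omega>)) U \<and> u \<in> U \<and>
    (\<forall>h\<ge>H. \<forall>v\<in>U. energy X \<Omega> f u - e \<le> energy X \<Omega> (fh h) v)"
proof -
  have Lp: "Xgrad X \<Omega> v \<in> Lp p \<Omega>" if "v \<in> V" for v using V that Xgrad_W1pX(2) by blast
  have "0 < e / 2" using e by simp
  from uniform_affine_minorant[OF Lp[OF u] this] obtain \<xi> K N
    where \<xi>: "\<xi> \<in> borel_measurable (lebesgue_on \<Omega>)" "\<forall>x. norm (\<xi> x) \<le> K"
      and min: "\<forall>h\<ge>N. \<forall>v\<in>Lp p \<Omega>. (LINT x|lebesgue_on \<Omega>. f x (Xgrad X \<Omega> u x)) + (LINT x|lebesgue_on \<Omega>. \<xi> x \<bullet> v x)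
        - (LINT x|lebesgue_on \<Omega>. \<xi> x \<bullet> Xgrad X \<Omega> u x) - e / 2 \<le> (LINT x|lebesgue_on \<Omega>. fh h x (v x))"
    by (elim exE conjE)
  define l where "l u = (LINT x|lebesgue_on \<Omega>. \<xi> x \<bullet> Xgrad X \<Omega> u x)" for u
  have l: "l \<in> dual_of V (W1pX_norm X p \<Omega>)"
    unfolding l_def using gradient_functional_in_dual[OF \<xi>(1) _ V] \<xi>(2) by blast
  show ?thesis
  proof (intro exI conjI allI impI ballI)
    show "openin (weak_topology_of V (W1pX_norm X p \<Omega>)) {v \<in> V. l v \<in> {l u - e / 2<..}}"
      by (intro openin_weak_topology_of l open_greaterThan)
    show "u \<in> {v \<in> V. l v \<in> {l u - e / 2<..}}" using u e by simp
    fix h v assume h: "N \<le> h" and v: "v \<in> {v \<in> V. l v \<in> {l u - e / 2<..}}"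
    then have "energy X \<Omega> f u + l v - l u - e / 2 \<le> energy X \<Omega> (fh h) v"
      unfolding energy_def l_def using min Lp by blast
    then show "energy X \<Omega> f u - e \<le> energy X \<Omega> (fh h) v" using v by simp
  qed
qed

lemma energy_tendsto:
  assumes "u \<in> W1pX X p \<Omega>"
  shows "(\<lambda>h. energy X \<Omega> (fh h) u) \<longlonglongrightarrow> energy X \<Omega> f u"
  unfolding energy_def by (rule integral_fh_tendsto[OF Xgrad_W1pX(2)[OF assms]])

theorem Gamma_converges_energy:
  assumes V: "V \<subseteq> W1pX X p \<Omega>"
  shows "Gamma_converges (weak_topology_of V (W1pX_norm X p \<Omega>)) (\<lambda>h. energy X \<Omega> (fh h)) (energy X \<Omega> f)"
  using energy_lower_semicontinuous[OF V] energy_tendsto V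
  by (intro Gamma_convergesI) (auto simp: topspace_weak_topology_of)

end

section \<open>Lower order perturbations\<close>

context sobolev_setting
begin

lemma Lp_diff:
  fixes u v :: "real^'n \<Rightarrow> 'b::euclidean_space"
  assumes u: "u \<in> Lp p \<Omega>" and v: "v \<in> Lp p \<Omega>"
  shows "(\<lambda>x. u x - v x) \<in> Lp p \<Omega>"
proof -
  have [measurable]: "u \<in> borel_measurable (lebesgue_on \<Omega>)" "v \<in> borel_measurable (lebesgue_on \<Omega>)"
    using u v unfolding Lp_def by blast+
  have bound: "norm (a - b) powr p \<le> 2 powr p * (norm a powr p + norm b powr p)" for a b :: 'b
  proof -
    have "norm (a - b) \<le> 2 * max (norm a) (norm b)"
      using norm_triangle_ineq4[of a b] by simp
    then have "norm (a - b) powr p \<le> (2 * max (norm a) (norm b)) powr p"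
      using p by (intro powr_mono2) auto
    also have "\<dots> = 2 powr p * max (norm a) (norm b) powr p"
      by (simp add: powr_mult)
    also have "\<dots> \<le> 2 powr p * (norm a powr p + norm b powr p)"
      by (intro mult_left_mono) (auto simp: max_def)
    finally show ?thesis .
  qed
  have "integrable (lebesgue_on \<Omega>) (\<lambda>x. norm (u x - v x) powr p)"
  proof (rule Bochner_Integration.integrable_bound)
    show "integrable (lebesgue_on \<Omega>) (\<lambda>x. 2 powr p * (norm (u x) powr p + norm (v x) powr p))"
      using u v unfolding Lp_def by auto
    show "AE x in lebesgue_on \<Omega>. norm (norm (u x - v x) powr p) \<le> norm (2 powr p * (norm (u x) powr p + norm (v x) powr p))"
      using bound by (intro AE_I2) (simp add: abs_mult)
  qed measurable
  then show ?thesis unfolding Lp_def by auto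
qed

text \<open>
  Superposition with a simple function is measurable by countability of its range; the general
  case follows by continuity in the second argument. The limit exists only almost everywhere, so
  completeness of Lebesgue measure is used.
\<close>

lemma caratheodory_measurable:
  fixes u :: "real^'n \<Rightarrow> real"
  assumes g: "caratheodory \<Omega> g" and u: "u \<in> borel_measurable (lebesgue_on \<Omega>)"
  shows "(\<lambda>x. g x (u x)) \<in> borel_measurable (lebesgue_on \<Omega>)"
proof -
  have gm: "(\<lambda>x. g x s) \<in> borel_measurable (lebesgue_on \<Omega>)" for s
    using g unfolding caratheodory_def by blast
  obtain F where F: "\<And>i. simple_function (lebesgue_on \<Omega>) (F i)"
    and F_lim: "\<And>x. x \<in> \<Omega> \<Longrightarrow> (\<lambda>i. F i x) \<longlonglongrightarrow> u x"
    using borel_measurable_implies_sequence_metric[OF u, of 0] by auto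
  have simple: "(\<lambda>x. g x (F i x)) \<in> borel_measurable (lebesgue_on \<Omega>)" for i
  proof (rule measurable_compose_countable'[where I = "F i ` \<Omega>" and f = "\<lambda>s x. g x s"])
    have fin: "finite (F i ` \<Omega>)" using F[of i] unfolding simple_function_def by simp
    then show "countable (F i ` \<Omega>)" by (rule countable_finite)
    show "F i \<in> measurable (lebesgue_on \<Omega>) (count_space (F i ` \<Omega>))"
      using F[of i] unfolding simple_function_def by (subst measurable_count_space_eq2[OF fin]) auto
  qed (rule gm)
  define G where "G x = lim (\<lambda>i. g x (F i x))" for x
  have G: "G \<in> borel_measurable (lebesgue_on \<Omega>)"
    unfolding G_def using simple by (rule borel_measurable_lim_metric)
  have ae: "AE x in lebesgue_on \<Omega>. G x = g x (u x)"
  proof -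
    have "AE x in lebesgue_on \<Omega>. continuous_on UNIV (g x)" using g unfolding caratheodory_def by blast
    moreover have "AE x in lebesgue_on \<Omega>. x \<in> \<Omega>" by (rule AE_I2) simp
    ultimately show ?thesis
    proof eventually_elim
      case (elim x)
      then have "(\<lambda>i. g x (F i x)) \<longlonglongrightarrow> g x (u x)"
        using F_lim by (intro continuous_on_tendsto_compose[OF elim(1)]) auto
      then show ?case unfolding G_def by (rule limI)
    qed
  qed
  have "(\<lambda>x. if x \<in> \<Omega> then G x else 0) \<in> borel_measurable lebesgue"
    using G sets_\<Omega> by (simp add: borel_measurable_if)
  moreover have "AE x in lebesgue. (if x \<in> \<Omega> then G x else 0) = (if x \<in> \<Omega> then g x (u x) else 0)"
    using ae sets_\<Omega> by (auto simp: AE_restrict_space_iff elim!: eventually_mono)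
  ultimately have "(\<lambda>x. if x \<in> \<Omega> then g x (u x) else 0) \<in> borel_measurable lebesgue"
    by (rule borel_measurable_AE)
  then show ?thesis by (rule borel_measurable_if_D)
qed

lemma borel_measurable_indicator_rat_box:
  assumes "Q \<in> rat_boxes"
  shows "indicat_real Q \<in> borel_measurable (lebesgue_on \<Omega>)"
proof -
  obtain a b where "Q = box a b" using assms unfolding rat_boxes_def by blast
  then show ?thesis
    by (intro measurable_restrict_space1 borel_measurable_indicator) simp
qed

lemma AE_eq_if_integral_rat_boxes_eq:
  fixes u v :: "real^'n \<Rightarrow> real"
  assumes u: "integrable (lebesgue_on \<Omega>) u" and v: "integrable (lebesgue_on \<Omega>) v"
    and eq: "\<And>Q. Q \<in> rat_boxes \<Longrightarrow> (LINT x|lebesgue_on \<Omega>. indicator Q x \<bullet> u x) = (LINT x|lebesgue_on \<Omega>. indicator Q x \<bullet> v x)"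
  shows "AE x in lebesgue_on \<Omega>. u x = v x"
proof -
  define W where "W x = (if x \<in> \<Omega> then u x - v x else 0)" for x
  have "AE x in lebesgue. W x = 0"
  proof (rule AE_zero_if_integral_rat_boxes_zero)
    show "integrable lebesgue W"
      unfolding W_def using u v sets_\<Omega> by (simp add: Lebesgue_Measure.integrable_restrict_UNIV)
    fix Q :: "(real^'n) set" assume Q: "Q \<in> rat_boxes"
    have Qm: "indicat_real Q \<in> borel_measurable (lebesgue_on \<Omega>)"
      by (rule borel_measurable_indicator_rat_box[OF Q])
    have i: "integrable (lebesgue_on \<Omega>) (\<lambda>x. indicat_real Q x \<bullet> w x)" if "integrable (lebesgue_on \<Omega>) w" for w
      using integrable_bounded_inner(1)[OF Qm _ that, of 1] by (simp add: indicator_def)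
    have "(LINT x:Q|lebesgue. W x) = (LINT x|lebesgue. (if x \<in> \<Omega> then indicator Q x \<bullet> u x - indicator Q x \<bullet> v x else 0))"
      unfolding set_lebesgue_integral_def
      by (intro Bochner_Integration.integral_cong) (auto simp: W_def right_diff_distrib)
    also have "\<dots> = (LINT x|lebesgue_on \<Omega>. indicator Q x \<bullet> u x - indicator Q x \<bullet> v x)"
      by (rule Lebesgue_Measure.integral_restrict_UNIV[OF sets_\<Omega>])
    also have "\<dots> = 0"
      using eq[OF Q] i[OF u] i[OF v] by (simp del: inner_real_def)
    finally show "(LINT x:Q|lebesgue. W x) = 0" .
  qed
  then show ?thesis
    using sets_\<Omega> by (auto simp: AE_restrict_space_iff W_def elim!: eventually_mono)
qed

end

locale lower_order_growth = sobolev_setting \<Omega> \<Omega>0 X p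
  for \<Omega> \<Omega>0 :: "(real^'n::finite) set" and X :: "'m::finite \<Rightarrow> real^'n \<Rightarrow> real^'n" and p :: real +
  fixes g :: "real^'n \<Rightarrow> real \<Rightarrow> real" and d0 d1 :: real and b0 b1 :: "real^'n \<Rightarrow> real"
  assumes g: "caratheodory \<Omega> g" and d0: "0 < d0" and d1: "d0 \<le> d1"
    and b0: "integrable (lebesgue_on \<Omega>) b0" and b1: "integrable (lebesgue_on \<Omega>) b1"
    and growth: "AE x in lebesgue_on \<Omega>. \<forall>s. d0 * \<bar>s\<bar> powr p - b0 x \<le> g x s \<and> g x s \<le> d1 * \<bar>s\<bar> powr p + b1 x"
begin

lemma integrable_g:
  assumes u: "u \<in> Lp p \<Omega>"
  shows "integrable (lebesgue_on \<Omega>) (\<lambda>x. g x (u x))"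
proof (rule Bochner_Integration.integrable_bound)
  show "integrable (lebesgue_on \<Omega>) (\<lambda>x. d1 * \<bar>u x\<bar> powr p + \<bar>b0 x\<bar> + \<bar>b1 x\<bar>)"
    using u b0 b1 unfolding Lp_def by auto
  show "(\<lambda>x. g x (u x)) \<in> borel_measurable (lebesgue_on \<Omega>)"
    using u unfolding Lp_def by (intro caratheodory_measurable[OF g]) auto
  show "AE x in lebesgue_on \<Omega>. norm (g x (u x)) \<le> norm (d1 * \<bar>u x\<bar> powr p + \<bar>b0 x\<bar> + \<bar>b1 x\<bar>)"
    using growth
  proof eventually_elim
    case (elim x)
    have "0 \<le> d0 * \<bar>u x\<bar> powr p" "0 \<le> d1 * \<bar>u x\<bar> powr p" using d0 d1 by auto
    with spec[OF elim, of "u x"] show ?case by (simp only: real_norm_def) linarith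
  qed
qed

lemma lower_order_coercive:
  assumes u: "u \<in> Lp p \<Omega>"
  shows "d0 * (LINT x|lebesgue_on \<Omega>. \<bar>u x\<bar> powr p) - (LINT x|lebesgue_on \<Omega>. b0 x) \<le> lower_order \<Omega> g u"
proof -
  have i: "integrable (lebesgue_on \<Omega>) (\<lambda>x. \<bar>u x\<bar> powr p)" using u unfolding Lp_def by simp
  have "(LINT x|lebesgue_on \<Omega>. d0 * \<bar>u x\<bar> powr p - b0 x) \<le> (LINT x|lebesgue_on \<Omega>. g x (u x))"
    using growth i b0 integrable_g[OF u] by (intro integral_mono_AE) (auto elim!: eventually_mono)
  then show ?thesis unfolding lower_order_def using i b0 by simp
qed

text \<open>
  This is Fatou's lemma, in the form of dominated convergence for the minimum of \<open>g x (v k x)\<close> and \<open>g x (u x)\<close>,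
  which is bounded above by \<open>g x (u x)\<close> and below by the smaller of this value and \<open>- b0 x\<close>.
\<close>

lemma lower_order_lsc_AE:
  assumes v: "\<And>k. v k \<in> Lp p \<Omega>" and u: "u \<in> Lp p \<Omega>"
    and ae: "AE x in lebesgue_on \<Omega>. (\<lambda>k. v k x) \<longlonglongrightarrow> u x" and e: "0 < e"
  shows "\<exists>k::nat. lower_order \<Omega> g u - e \<le> lower_order \<Omega> g (v k)"
proof -
  \<comment> \<open>The minimum converges to \<open>g x (u x)\<close> as well, and its integral is at most that of \<open>g x (v k x)\<close>.\<close>
  let ?m = "\<lambda>k x. min (g x (v k x)) (g x (u x))"
  have m: "integrable (lebesgue_on \<Omega>) (?m k)" for k
    by (intro integrable_min integrable_g v u)
  have "(\<lambda>k. LINT x|lebesgue_on \<Omega>. ?m k x) \<longlonglongrightarrow> (LINT x|lebesgue_on \<Omega>. g x (u x))"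
  proof (rule integral_dominated_convergence[where w = "\<lambda>x. \<bar>g x (u x)\<bar> + \<bar>b0 x\<bar>"])
    have "AE x in lebesgue_on \<Omega>. continuous_on UNIV (g x)" using g unfolding caratheodory_def by blast
    with ae show "AE x in lebesgue_on \<Omega>. (\<lambda>k. ?m k x) \<longlonglongrightarrow> g x (u x)"
    proof eventually_elim
      case (elim x)
      then have "(\<lambda>k. g x (v k x)) \<longlonglongrightarrow> g x (u x)"
        by (intro continuous_on_tendsto_compose[OF elim(2)]) auto
      from tendsto_min[OF this tendsto_const[of "g x (u x)"]] show ?case by simp
    qed
    show "AE x in lebesgue_on \<Omega>. norm (?m k x) \<le> \<bar>g x (u x)\<bar> + \<bar>b0 x\<bar>" for k
      using growth
    proof eventually_elim
      case (elim x)
      have "0 \<le> d0 * \<bar>v k x\<bar> powr p" using d0 by simp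
      with spec[OF elim, of "v k x"] show ?case by (auto simp: min_def)
    qed
  qed (use m integrable_g[OF u] b0 in auto)
  then have "eventually (\<lambda>k. lower_order \<Omega> g u - e < (LINT x|lebesgue_on \<Omega>. ?m k x)) sequentially"
    unfolding lower_order_def using e by (intro order_tendstoD(1)) auto
  then obtain k where "lower_order \<Omega> g u - e < (LINT x|lebesgue_on \<Omega>. ?m k x)"
    unfolding eventually_sequentially by blast
  also have "\<dots> \<le> lower_order \<Omega> g (v k)"
    unfolding lower_order_def using m integrable_g v by (intro integral_mono) auto
  finally show ?thesis by (intro exI[of _ k]) simp
qed

text \<open>
  Otherwise there is, for each \<open>n\<close>, a function \<open>v n\<close> of norm at most \<open>M\<close> violating the
  conclusion whose integrals over the rational boxes of index at most \<open>n\<close> are within \<open>1 / Suc n\<close> of those of \<open>u\<close>.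
  A subsequence converges in \<open>L\<^sup>p\<close>; its limit has the same integrals as \<open>u\<close>, so it is \<open>u\<close>.
\<close>

lemma lower_order_weakly_lsc_on_bounded:
  assumes compact: "compactly_embedded_in_Lp X p \<Omega>" and u: "u \<in> W1pX X p \<Omega>" and e: "0 < e"
  shows "\<exists>U. openin (weak_topology_of (W1pX X p \<Omega>) (W1pX_norm X p \<Omega>)) U \<and> u \<in> U \<and>
    (\<forall>v\<in>U. W1pX_norm X p \<Omega> v \<le> M \<longrightarrow> lower_order \<Omega> g u - e \<le> lower_order \<Omega> g v)"
proof (rule ccontr)
  let ?V = "W1pX X p \<Omega>" and ?T = "weak_topology_of (W1pX X p \<Omega>) (W1pX_norm X p \<Omega>)"
  assume contra: "\<not> ?thesis"
  have Lp: "v \<in> Lp p \<Omega>" if "v \<in> ?V" for v using that unfolding W1pX_def by blast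
  have ne: "rat_boxes \<noteq> ({} :: (real^'n) set set)"
    unfolding rat_boxes_def by (auto intro!: exI[of _ 0])
  define Q :: "nat \<Rightarrow> (real^'n) set" where "Q = from_nat_into rat_boxes"
  have Q_range: "range Q = rat_boxes"
    unfolding Q_def using range_from_nat_into[OF ne countable_rat_boxes] .
  have Qm: "indicat_real (Q i) \<in> borel_measurable (lebesgue_on \<Omega>)" for i
    using Q_range by (intro borel_measurable_indicator_rat_box) blast
  have Qb: "norm (indicat_real (Q i) x) \<le> 1" for i x by (simp add: indicator_def)
  define l where "l i v = (LINT x|lebesgue_on \<Omega>. indicat_real (Q i) x \<bullet> v x)" for i v
  have l: "l i \<in> dual_of ?V (W1pX_norm X p \<Omega>)" for i
    unfolding l_def by (rule function_functional_in_dual[OF Qm Qb order_refl])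
  define U where "U n = (\<Inter>i\<in>{..n}. {v \<in> ?V. l i v \<in> ball (l i u) (1 / real (Suc n))})" for n
  have U_open: "openin ?T (U n)" for n
    unfolding U_def by (intro openin_INT2 openin_weak_topology_of l open_ball) auto
  have u_U: "u \<in> U n" for n
    unfolding U_def using u by simp
  have "\<exists>v. v \<in> U n \<and> W1pX_norm X p \<Omega> v \<le> M \<and> lower_order \<Omega> g v < lower_order \<Omega> g u - e" for n
  proof -
    have "\<not> (\<forall>v\<in>U n. W1pX_norm X p \<Omega> v \<le> M \<longrightarrow> lower_order \<Omega> g u - e \<le> lower_order \<Omega> g v)"
      using contra U_open[of n] u_U[of n] by blast
    then show ?thesis unfolding not_le[symmetric] by blast
  qed
  then have "\<exists>v. \<forall>n. v n \<in> U n \<and> W1pX_norm X p \<Omega> (v n) \<le> M \<and> lower_order \<Omega> g (v n) < lower_order \<Omega> g u - e"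
    by (intro choice) blast
  then obtain v where v: "\<And>n. v n \<in> U n" "\<And>n. W1pX_norm X p \<Omega> (v n) \<le> M"
      "\<And>n. lower_order \<Omega> g (v n) < lower_order \<Omega> g u - e"
    by blast
  have vV: "v n \<in> ?V" for n using v(1)[of n] unfolding U_def by auto
  obtain w r where w: "w \<in> Lp p \<Omega>" and r: "strict_mono r"
    and lim: "(\<lambda>k. Lp_norm p \<Omega> (\<lambda>x. v (r k) x - w x)) \<longlonglongrightarrow> 0"
    using compact vV v(2) unfolding compactly_embedded_in_Lp_def by blast
  define z where "z k x = v (r k) x - w x" for k x
  have z: "z k \<in> Lp p \<Omega>" for k unfolding z_def by (intro Lp_diff Lp vV w)
  have z_L1: "(\<lambda>k. LINT x|lebesgue_on \<Omega>. norm (z k x)) \<longlonglongrightarrow> 0"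
  proof (rule tendsto_sandwich[OF _ _ tendsto_const])
    show "(\<lambda>k. (measure (lebesgue_on \<Omega>) \<Omega> + 1) * Lp_norm p \<Omega> (z k)) \<longlonglongrightarrow> 0"
      using tendsto_mult_right_zero[OF lim] unfolding z_def .
    show "eventually (\<lambda>k. (LINT x|lebesgue_on \<Omega>. norm (z k x)) \<le> (measure (lebesgue_on \<Omega>) \<Omega> + 1) * Lp_norm p \<Omega> (z k)) sequentially"
      using integral_norm_le_Lp_norm[OF z] by (intro always_eventually allI)
    show "eventually (\<lambda>k. 0 \<le> (LINT x|lebesgue_on \<Omega>. norm (z k x))) sequentially"
      by (intro always_eventually allI Bochner_Integration.integral_nonneg) simp
  qed
  have l_eq: "l i w = l i u" for i
  proof (rule LIMSEQ_unique)
    show "(\<lambda>k. l i (v (r k))) \<longlonglongrightarrow> l i w"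
    proof (rule LIM_zero_cancel, rule tendsto_rabs_zero_cancel, rule tendsto_sandwich[OF _ _ tendsto_const z_L1])
      have "\<bar>l i (v (r k)) - l i w\<bar> \<le> (LINT x|lebesgue_on \<Omega>. norm (z k x))" for k
      proof -
        have "l i (v (r k)) - l i w = (LINT x|lebesgue_on \<Omega>. indicat_real (Q i) x \<bullet> z k x)"
          unfolding l_def z_def
          using integrable_bounded_inner(1)[OF Qm Qb Lp_integrable[OF Lp[OF vV]]] integrable_bounded_inner(1)[OF Qm Qb Lp_integrable[OF w]]
          by (simp add: inner_diff_right del: inner_real_def)
        then show ?thesis
          using integrable_bounded_inner(2)[OF Qm Qb Lp_integrable[OF z]] by simp
      qed
      then show "eventually (\<lambda>k. \<bar>l i (v (r k)) - l i w\<bar> \<le> (LINT x|lebesgue_on \<Omega>. norm (z k x))) sequentially"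
        by (intro always_eventually allI)
    qed simp
    show "(\<lambda>k. l i (v (r k))) \<longlonglongrightarrow> l i u"
    proof (rule LIM_zero_cancel, rule tendsto_rabs_zero_cancel, rule tendsto_sandwich[OF _ _ tendsto_const])
      show "(\<lambda>k. 1 / real (Suc k)) \<longlonglongrightarrow> 0"
        using LIMSEQ_inverse_real_of_nat by (simp add: inverse_eq_divide)
      have "\<bar>l i (v (r k)) - l i u\<bar> \<le> 1 / real (Suc k)" if "k \<ge> i" for k
      proof -
        have "k \<le> r k" using r by (rule seq_suble)
        then have "\<bar>l i (v (r k)) - l i u\<bar> < 1 / real (Suc (r k))"
          using v(1)[of "r k"] that unfolding U_def by (auto simp: dist_real_def abs_minus_commute)
        also have "\<dots> \<le> 1 / real (Suc k)" using \<open>k \<le> r k\<close> by (simp add: frac_le)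
        finally show ?thesis by simp
      qed
      then show "eventually (\<lambda>k. \<bar>l i (v (r k)) - l i u\<bar> \<le> 1 / real (Suc k)) sequentially"
        unfolding eventually_sequentially by blast
    qed simp
  qed
  have w_u: "AE x in lebesgue_on \<Omega>. w x = u x"
  proof (rule AE_eq_if_integral_rat_boxes_eq[OF Lp_integrable[OF w] Lp_integrable[OF Lp[OF u]]])
    fix R :: "(real^'n) set" assume "R \<in> rat_boxes"
    then have "R \<in> range Q" by (simp only: Q_range)
    then obtain i where "R = Q i" ..
    then show "(LINT x|lebesgue_on \<Omega>. indicator R x \<bullet> w x) = (LINT x|lebesgue_on \<Omega>. indicator R x \<bullet> u x)"
      using l_eq[of i] unfolding l_def by simp
  qed
  obtain s where s: "AE x in lebesgue_on \<Omega>. (\<lambda>k. z (s k) x) \<longlonglongrightarrow> 0"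
    using tendsto_L1_AE_subseq[OF Lp_integrable[OF z] z_L1] by blast
  from w_u s have "AE x in lebesgue_on \<Omega>. (\<lambda>k. v (r (s k)) x) \<longlonglongrightarrow> u x"
  proof eventually_elim
    case (elim x)
    then show ?case unfolding z_def by (simp add: LIM_zero_iff)
  qed
  then obtain k where "lower_order \<Omega> g u - e \<le> lower_order \<Omega> g (v (r (s k)))"
    using lower_order_lsc_AE[of "\<lambda>k. v (r (s k))" u e] Lp vV u e by blast
  then show False using v(3)[of "r (s k)"] by simp
qed

end

locale converging_integrands_with_lower_order =
  converging_integrands \<Omega> \<Omega>0 X p c0 c1 a0 a1 fh f + lower_order_growth \<Omega> \<Omega>0 X p g d0 d1 b0 b1
  for \<Omega> \<Omega>0 :: "(real^'n::finite) set" and X :: "'m::finite \<Rightarrow> real^'n \<Rightarrow> real^'n"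
    and p c0 c1 a0 a1 fh f g d0 d1 b0 b1
begin

lemma energy_coercive:
  assumes v: "v \<in> W1pX X p \<Omega>"
  shows "c0 * (LINT x|lebesgue_on \<Omega>. norm (Xgrad X \<Omega> v x) powr p) - (LINT x|lebesgue_on \<Omega>. a0 x) \<le> energy X \<Omega> (fh h) v"
proof -
  have Lp: "Xgrad X \<Omega> v \<in> Lp p \<Omega>" by (rule Xgrad_W1pX(2)[OF v])
  then have i: "integrable (lebesgue_on \<Omega>) (\<lambda>x. norm (Xgrad X \<Omega> v x) powr p)" unfolding Lp_def by blast
  have "AE x in lebesgue_on \<Omega>. \<forall>\<eta>. c0 * norm \<eta> powr p - a0 x \<le> fh h x \<eta> \<and> fh h x \<eta> \<le> c1 * norm \<eta> powr p + a1 x"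
    using fh[of h] unfolding integrand_class_def by blast
  then have "(LINT x|lebesgue_on \<Omega>. c0 * norm (Xgrad X \<Omega> v x) powr p - a0 x) \<le> (LINT x|lebesgue_on \<Omega>. fh h x (Xgrad X \<Omega> v x))"
    using i a0 integrable_fh[OF Lp] by (intro integral_mono_AE) (auto elim!: eventually_mono)
  then show ?thesis unfolding energy_def using i a0 by simp
qed

lemma energy_plus_lower_order_coercive:
  "\<exists>C>0. \<exists>D. \<forall>h. \<forall>v\<in>W1pX X p \<Omega>. C * W1pX_norm X p \<Omega> v powr p - D \<le> energy X \<Omega> (fh h) v + lower_order \<Omega> g v"
proof (intro exI conjI allI ballI)
  let ?C = "min c0 d0"
  show "0 < ?C" using c0 d0 by simp
  fix h v assume v: "v \<in> W1pX X p \<Omega>"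
  let ?I = "LINT x|lebesgue_on \<Omega>. \<bar>v x\<bar> powr p" and ?J = "LINT x|lebesgue_on \<Omega>. norm (Xgrad X \<Omega> v x) powr p"
  have nn: "0 \<le> ?I" "0 \<le> ?J" by (auto intro!: Bochner_Integration.integral_nonneg)
  have "W1pX_norm X p \<Omega> v powr p = ?I + ?J"
    unfolding W1pX_norm_def using nn p by (simp add: powr_powr)
  then have "?C * W1pX_norm X p \<Omega> v powr p = ?C * ?I + ?C * ?J" by (simp add: distrib_left)
  also have "\<dots> \<le> d0 * ?I + c0 * ?J"
    using nn by (intro add_mono mult_right_mono) auto
  finally show "?C * W1pX_norm X p \<Omega> v powr p - ((LINT x|lebesgue_on \<Omega>. a0 x) + (LINT x|lebesgue_on \<Omega>. b0 x))
      \<le> energy X \<Omega> (fh h) v + lower_order \<Omega> g v"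
    using energy_coercive[OF v, of h] lower_order_coercive[of v] v unfolding W1pX_def by simp
qed

text \<open>
  The threshold \<open>M\<close> is such that above it coercivity alone bounds the functionals from below by
  the value of the limit at \<open>u\<close>; below it the lower bounds for the energy and for \<open>G\<close> are added.
\<close>

theorem Gamma_converges_energy_plus_lower_order:
  assumes compact: "compactly_embedded_in_Lp X p \<Omega>"
  shows "Gamma_converges (weak_topology_of (W1pX X p \<Omega>) (W1pX_norm X p \<Omega>))
    (\<lambda>h u. energy X \<Omega> (fh h) u + lower_order \<Omega> g u) (\<lambda>u. energy X \<Omega> f u + lower_order \<Omega> g u)"
proof (rule Gamma_convergesI)
  let ?T = "weak_topology_of (W1pX X p \<Omega>) (W1pX_norm X p \<Omega>)"
  fix u assume "u \<in> topspace ?T"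
  then have u: "u \<in> W1pX X p \<Omega>" by (simp add: topspace_weak_topology_of)
  show "(\<lambda>h. energy X \<Omega> (fh h) u + lower_order \<Omega> g u) \<longlonglongrightarrow> energy X \<Omega> f u + lower_order \<Omega> g u"
    by (intro tendsto_add energy_tendsto u tendsto_const)
  fix e :: real assume "0 < e"
  then have e: "0 < e / 2" by simp
  obtain U H where U: "openin ?T U" "u \<in> U" "\<forall>h\<ge>H. \<forall>v\<in>U. energy X \<Omega> f u - e / 2 \<le> energy X \<Omega> (fh h) v"
    using energy_lower_semicontinuous[OF order_refl u e] by (elim exE conjE)
  obtain C D where C: "0 < C" "\<forall>h. \<forall>v\<in>W1pX X p \<Omega>. C * W1pX_norm X p \<Omega> v powr p - D \<le> energy X \<Omega> (fh h) v + lower_order \<Omega> g v"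
    using energy_plus_lower_order_coercive by (elim exE conjE)
  define E where "E = energy X \<Omega> f u + lower_order \<Omega> g u"
  \<comment> \<open>Coercivity gives at least \<open>C * t - D \<ge> E\<close> as soon as the \<open>p\<close>-th power of the norm is at least \<open>t\<close>.\<close>
  define t where "t = max 0 ((E + D) / C)"
  define M where "M = t powr (1 / p)"
  obtain U' where U': "openin ?T U'" "u \<in> U'"
      "\<forall>v\<in>U'. W1pX_norm X p \<Omega> v \<le> M \<longrightarrow> lower_order \<Omega> g u - e / 2 \<le> lower_order \<Omega> g v"
    using lower_order_weakly_lsc_on_bounded[OF compact u e, of M] by (elim exE conjE)
  have "E - e \<le> energy X \<Omega> (fh h) v + lower_order \<Omega> g v" if h: "H \<le> h" and v: "v \<in> U \<inter> U'" for h v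
  proof (cases "W1pX_norm X p \<Omega> v \<le> M")
    case True
    then show ?thesis using U(3)[rule_format, OF h, of v] U'(3)[rule_format, of v] v unfolding E_def by simp
  next
    case False
    have "v \<in> W1pX X p \<Omega>" using v U(1) openin_subset topspace_weak_topology_of by fastforce
    have "t = M powr p" using p by (simp add: M_def t_def powr_powr)
    also have "\<dots> \<le> W1pX_norm X p \<Omega> v powr p"
      using False p by (intro powr_mono2) (auto simp: M_def)
    finally have "C * ((E + D) / C) \<le> C * W1pX_norm X p \<Omega> v powr p"
      using C(1) by (intro mult_left_mono) (auto simp: t_def)
    then have "E \<le> C * W1pX_norm X p \<Omega> v powr p - D" using C(1) by simp
    also have "\<dots> \<le> energy X \<Omega> (fh h) v + lower_order \<Omega> g v" using C(2) \<open>v \<in> W1pX X p \<Omega>\<close> by blast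
    finally show ?thesis using \<open>0 < e\<close> by simp
  qed
  then show "\<exists>U H. openin ?T U \<and> u \<in> U \<and> (\<forall>h\<ge>H. \<forall>v\<in>U. energy X \<Omega> f u + lower_order \<Omega> g u - e \<le> energy X \<Omega> (fh h) v + lower_order \<Omega> g v)"
    using U(1,2) U'(1,2) unfolding E_def by (intro exI[of _ "U \<inter> U'"] exI[of _ H]) auto
qed

end

section \<open>The Gamma-convergence theorem\<close>

theorem theorem3p1:
  fixes \<Omega> \<Omega>0 :: "(real^'n) set"
    and X :: "'m::finite \<Rightarrow> real^'n \<Rightarrow> real^'n"
    and p c0 c1 :: real
    and a0 a1 :: "real^'n \<Rightarrow> real"
    and fh :: "nat \<Rightarrow> real^'n \<Rightarrow> real^'m \<Rightarrow> real"
    and f :: "real^'n \<Rightarrow> real^'m \<Rightarrow> real"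
  assumes "open \<Omega>" and "bounded \<Omega>"
    and "1 < p"
    and "open \<Omega>0" and "closure \<Omega> \<subseteq> \<Omega>0"
    and "\<forall>j. \<exists>L. L-lipschitz_on \<Omega>0 (X j)"
    and "\<forall>j x. \<exists>\<epsilon>>0. \<exists>L. L-lipschitz_on (ball x \<epsilon>) (X j)"
    and "LIC X \<Omega>"
    and "H1 X \<Omega>0" and "H2 X \<Omega>0" and "H3 X \<Omega>0"
    and "0 < c0" and "c0 \<le> c1"
    and "nonneg_L1 \<Omega> a0" and "nonneg_L1 \<Omega> a1"
    and "ess_bounded \<Omega> a0" and "ess_bounded \<Omega> a1"
    and "\<forall>h. fh h \<in> integrand_class p \<Omega> c0 c1 a0 a1"
    and "f \<in> integrand_class p \<Omega> c0 c1 a0 a1"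
    and "\<forall>\<eta>. AE x in lebesgue_on \<Omega>. (\<lambda>h. fh h x \<eta>) \<longlonglongrightarrow> f x \<eta>"
  shows "Gamma_converges (weak_topology_of (W1pX0 X p \<Omega>) (W1pX_norm X p \<Omega>))
           (\<lambda>h. energy X \<Omega> (fh h)) (energy X \<Omega> f)
       \<and> (compactly_embedded_in_Lp X p \<Omega> \<longrightarrow>
           (\<forall>g d0 d1 b0 b1.
              caratheodory \<Omega> g \<and> 0 < d0 \<and> d0 \<le> d1 \<and> nonneg_L1 \<Omega> b0 \<and> nonneg_L1 \<Omega> b1 \<and>
              (AE x in lebesgue_on \<Omega>. \<forall>s. d0 * \<bar>s\<bar> powr p - b0 x \<le> g x s \<and> g x s \<le> d1 * \<bar>s\<bar> powr p + b1 x)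
              \<longrightarrow> Gamma_converges (weak_topology_of (W1pX X p \<Omega>) (W1pX_norm X p \<Omega>))
                    (\<lambda>h u. energy X \<Omega> (fh h) u + lower_order \<Omega> g u)
                    (\<lambda>u. energy X \<Omega> f u + lower_order \<Omega> g u)))"
proof -
  interpret converging_integrands \<Omega> \<Omega>0 X p c0 c1 a0 a1 fh f
    using assms unfolding nonneg_L1_def by unfold_locales blast+
  have "Gamma_converges (weak_topology_of (W1pX0 X p \<Omega>) (W1pX_norm X p \<Omega>))
      (\<lambda>h. energy X \<Omega> (fh h)) (energy X \<Omega> f)"
    by (rule Gamma_converges_energy) (auto simp: W1pX0_def)
  moreover have "Gamma_converges (weak_topology_of (W1pX X p \<Omega>) (W1pX_norm X p \<Omega>))
      (\<lambda>h u. energy X \<Omega> (fh h) u + lower_order \<Omega> g u) (\<lambda>u. energy X \<Omega> f u + lower_order \<Omega> g u)"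
    if "compactly_embedded_in_Lp X p \<Omega>"
      and "caratheodory \<Omega> g \<and> 0 < d0 \<and> d0 \<le> d1 \<and> nonneg_L1 \<Omega> b0 \<and> nonneg_L1 \<Omega> b1 \<and>
        (AE x in lebesgue_on \<Omega>. \<forall>s. d0 * \<bar>s\<bar> powr p - b0 x \<le> g x s \<and> g x s \<le> d1 * \<bar>s\<bar> powr p + b1 x)"
    for g d0 d1 b0 b1
  proof -
    interpret converging_integrands_with_lower_order \<Omega> \<Omega>0 X p c0 c1 a0 a1 fh f g d0 d1 b0 b1
      using that(2) unfolding nonneg_L1_def by unfold_locales blast+
    show ?thesis by (rule Gamma_converges_energy_plus_lower_order[OF that(1)])
  qed
  ultimately show ?thesis by blast
qed

end
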